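(* The set of zeros of the function $t_{0,0}(\lambda)$ in the sector $\Omega_0^-$ of the form $\mu\zeta_2$ with $\mu>0$, as well as the set of its zeros in $\Omega_0^-$ of the form $\nu\zeta_1$ with $\nu<0$, is at most finite; moreover, all these zeros have multiplicity two.
   Context: Setting: $m:\mathbb{R}\to\mathbb{R}$ is a measurable function having limits $m_\pm=\lim_{x\to\pm\infty}m(x)$ with $0<m_\pm<\infty$, and there is $a>0$ with $\int_{\mathbb{R}_\pm}|m(x)-m_\pm|^2e^{2a|x|}dx<\infty$. Put $n_\pm=m_\pm^{1/3}>0$, $z_\pm=\lambda n_\pm$. Let $\zeta_0=1$, $\zeta_1=\frac12(-1+i\sqrt3)$, $\zeta_2=\frac12(-1-i\sqrt3)$ and $s_2(z)=\frac13\left(e^{\zeta_0z}+\zeta_1^{-2}e^{\zeta_1z}+\zeta_2^{-2}e^{\zeta_2z}\right)$. The equation is $iy'''(x)=m(x)\lambda^3y(x)$, $x\in\mathbb{R}$. Sectors: $\Omega_0=\{\alpha+i\beta:\ \alpha,\beta\in\mathbb{R},\ |\alpha|<\sqrt3\,\beta\}$ and $\Omega_0^-=\{\lambda:-\lambda\in\Omega_0\}$. For $\lambda\in\Omega_0$: $v_0(\lambda,x)=e^{iz_+x}\psi_0(\lambda,x)$, where $\psi_0$ is the solution (given by the convergent Neumann series) of $\psi_0(\lambda,x)=1-iz_+\int_x^\infty e^{iz_+(t-x)}s_2(iz_+(x-t))\left(\frac{m(t)}{m_+}-1\right)\psi_0(\lambda,t)dt$. For $\lambda\in\Omega_0^-$: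 $u_0(\lambda,x)=e^{iz_-x}\varphi_0(\lambda,x)$, where $\varphi_0$ is the solution (given by the convergent Neumann series) of $\varphi_0(\lambda,x)=1+iz_-\int_{-\infty}^xe^{iz_-(t-x)}s_2(iz_-(x-t))\left(\frac{m(t)}{m_-}-1\right)\varphi_0(\lambda,t)dt$. These are solutions of the equation (Jost solutions at $+\infty$ and $-\infty$). For $\lambda\in\Omega_0^-$ put $v_0^+(\lambda,x)=\overline{v_0(\overline\lambda,x)}$ (then $\overline\lambda\in\Omega_0$). The function $t_{0,0}$ on $\Omega_0^-$ is $$t_{0,0}(\lambda)=\frac{n_+}{3\lambda^2}\left\{u_0(\lambda,x)(v_0^+(\lambda,x))''-u_0'(\lambda,x)(v_0^+(\lambda,x))'+u_0''(\lambda,x)v_0^+(\lambda,x)\right\},$$ primes denoting $d/dx$; the right-hand side does not depend on $x$ and is holomorphic in $\lambda\in\Omega_0^-$. *)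

theory Defs
  imports "HOL-Complex_Analysis.Complex_Analysis"
begin

definition zeta1 :: complex where
  "zeta1 = (-1 + \<i> * of_real (sqrt 3)) / 2"

definition zeta2 :: complex where
  "zeta2 = (-1 - \<i> * of_real (sqrt 3)) / 2"

definition s2 :: "complex \<Rightarrow> complex" where
  "s2 z = (exp z + inverse (zeta1 ^ 2) * exp (zeta1 * z) + inverse (zeta2 ^ 2) * exp (zeta2 * z)) / 3"

definition Omega0 :: "complex set" where
  "Omega0 = {w. \<bar>Re w\<bar> < sqrt 3 * Im w}"

definition Omega0_minus :: "complex set" where
  "Omega0_minus = {w. - w \<in> Omega0}"

text \<open>
  In the definitions below \<open>mp\<close> and \<open>mm\<close> stand for the limits of \<open>m\<close> at plus and minus infinity,
  and \<open>zpar c \<lambda>\<close> is \<open>\<lambda>\<close> times the cube root of \<open>c\<close>.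
\<close>

definition zpar :: "real \<Rightarrow> complex \<Rightarrow> complex" where
  "zpar c w = w * of_real (root 3 c)"

text \<open>
  The terms of the Neumann series: \<open>psi0_term m mp \<lambda> n\<close> is the \<open>n\<close>-th iterate, on the constant
  function 1, of the integral operator in
  \<open>\<psi> x = 1 - i z \<integral>\<^sub>x\<^sup>\<infinity> exp (i z (t - x)) s2 (i z (x - t)) (m t / mp - 1) \<psi> t dt\<close>, with \<open>z = zpar mp \<lambda>\<close>.
\<close>

primrec psi0_term :: "(real \<Rightarrow> real) \<Rightarrow> real \<Rightarrow> complex \<Rightarrow> nat \<Rightarrow> real \<Rightarrow> complex" where
  "psi0_term m mp w 0 = (\<lambda>x. 1)"
| "psi0_term m mp w (Suc n) = (\<lambda>x. - \<i> * zpar mp w *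
     (LINT t:{x..}|lebesgue. exp (\<i> * zpar mp w * of_real (t - x)) * s2 (\<i> * zpar mp w * of_real (x - t))
        * of_real (m t / mp - 1) * psi0_term m mp w n t))"

definition psi0 :: "(real \<Rightarrow> real) \<Rightarrow> real \<Rightarrow> complex \<Rightarrow> real \<Rightarrow> complex" where
  "psi0 m mp w x = (\<Sum>n. psi0_term m mp w n x)"

text \<open>
  Likewise for
  \<open>\<phi> x = 1 + i z \<integral>\<^sub>-\<^sub>\<infinity>\<^sup>x exp (i z (t - x)) s2 (i z (x - t)) (m t / mm - 1) \<phi> t dt\<close>, with \<open>z = zpar mm \<lambda>\<close>.
\<close>

primrec phi0_term :: "(real \<Rightarrow> real) \<Rightarrow> real \<Rightarrow> complex \<Rightarrow> nat \<Rightarrow> real \<Rightarrow> complex" where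
  "phi0_term m mm w 0 = (\<lambda>x. 1)"
| "phi0_term m mm w (Suc n) = (\<lambda>x. \<i> * zpar mm w *
     (LINT t:{..x}|lebesgue. exp (\<i> * zpar mm w * of_real (t - x)) * s2 (\<i> * zpar mm w * of_real (x - t))
        * of_real (m t / mm - 1) * phi0_term m mm w n t))"

definition phi0 :: "(real \<Rightarrow> real) \<Rightarrow> real \<Rightarrow> complex \<Rightarrow> real \<Rightarrow> complex" where
  "phi0 m mm w x = (\<Sum>n. phi0_term m mm w n x)"

definition v0 :: "(real \<Rightarrow> real) \<Rightarrow> real \<Rightarrow> complex \<Rightarrow> real \<Rightarrow> complex" where
  "v0 m mp w x = exp (\<i> * zpar mp w * of_real x) * psi0 m mp w x"

definition u0 :: "(real \<Rightarrow> real) \<Rightarrow> real \<Rightarrow> complex \<Rightarrow> real \<Rightarrow> complex" where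
  "u0 m mm w x = exp (\<i> * zpar mm w * of_real x) * phi0 m mm w x"

definition v0_plus :: "(real \<Rightarrow> real) \<Rightarrow> real \<Rightarrow> complex \<Rightarrow> real \<Rightarrow> complex" where
  "v0_plus m mp w x = cnj (v0 m mp (cnj w) x)"

definition Dx :: "(real \<Rightarrow> complex) \<Rightarrow> real \<Rightarrow> complex" where
  "Dx f x = vector_derivative f (at x)"

text \<open>
  The value at \<open>x\<close> of the bilinear concomitant defining \<open>t\<^sub>0\<^sub>,\<^sub>0\<close>. For \<open>\<lambda>\<close> in \<open>Omega0_minus\<close> it does not
  depend on \<open>x\<close>; it is kept here as an argument so that no particular point is singled out.
\<close>

definition t00 :: "(real \<Rightarrow> real) \<Rightarrow> real \<Rightarrow> real \<Rightarrow> real \<Rightarrow> complex \<Rightarrow> complex" where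
  "t00 m mp mm x w = of_real (root 3 mp) / (3 * w ^ 2) *
     (u0 m mm w x * Dx (Dx (v0_plus m mp w)) x
      - Dx (u0 m mm w) x * Dx (v0_plus m mp w) x
      + Dx (Dx (u0 m mm w)) x * v0_plus m mp w x)"

end

theory Submission
  imports Defs
begin

text \<open>
  On the two rays \<open>\<lambda>\<^sup>3\<close> is real, and then \<open>t\<^sub>0\<^sub>,\<^sub>0\<close> has no zeros at all, so both sets are empty and the
  claim about multiplicities is vacuous.

  Let \<open>u = u\<^sub>0(\<lambda>, -)\<close>. For real \<open>\<lambda>\<^sup>3\<close> the flux \<open>2 Re (u'' cnj u) - |u'|\<^sup>2\<close> is constant, and it vanishes because
  \<open>u\<close> and its derivatives decay at minus infinity. Hence \<open>(|u|\<^sup>2)'' = 3 |u'|\<^sup>2\<close>, so \<open>|u|\<^sup>2\<close> is convex and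
  decays at minus infinity, which forces \<open>Re (u' cnj u) > 0\<close> everywhere. By reflection
  \<open>v = v\<^sub>0\<^sup>+(\<lambda>, -)\<close> has zero flux too, with \<open>Re (v' cnj v) < 0\<close>. If \<open>u v'' - u' v' + u'' v = 0\<close>,
  then \<open>p = u'/u\<close> and \<open>r = v'/v\<close> satisfy \<open>|p|\<^sup>2/2 + |r|\<^sup>2/2 = Re (p r)\<close>, that is
  \<open>p = cnj r\<close>, which contradicts the signs of \<open>Re p\<close> and \<open>Re r\<close>.
\<close>

section \<open>Primitives taken from minus infinity\<close>

definition primitive :: "(real \<Rightarrow> 'a::euclidean_space) \<Rightarrow> real \<Rightarrow> 'a" where
  "primitive g y = (LINT t:{..y}|lebesgue. g t)"

text \<open>Half-lines are used because in the application the integrand \<open>m t / c - 1\<close>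
  tends at plus infinity to a constant that may be nonzero.\<close>

definition left_integrable :: "(real \<Rightarrow> 'a::euclidean_space) \<Rightarrow> bool" where
  "left_integrable g \<longleftrightarrow> (\<forall>y. set_integrable lebesgue {..y} g)"

lemma left_integrableD: "left_integrable g \<Longrightarrow> set_integrable lebesgue {..y} g"
  by (simp add: left_integrable_def)

lemma left_integrable_norm: "left_integrable g \<Longrightarrow> left_integrable (\<lambda>t. norm (g t))"
  unfolding left_integrable_def by (blast intro: set_integrable_norm)

lemma left_integrable_subset:
  assumes "left_integrable g" "A \<in> sets lebesgue" "A \<subseteq> {..y}"
  shows "set_integrable lebesgue A g"
  using assms set_integrable_subset left_integrableD by blast

lemma primitive_split:
  assumes "left_integrable g" "x \<le> y"
  shows "primitive g y = primitive g x + (LINT t:{x<..y}|lebesgue. g t)"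
proof -
  have "{..y} = {..x} \<union> {x<..y}" using assms by auto
  then show ?thesis
    unfolding primitive_def
    using left_integrable_subset[OF assms(1), of "{x<..y}" y] left_integrableD[OF assms(1), of x]
    by (simp only:, intro set_integral_Un) auto
qed

text \<open>Near \<open>x\<close> the function differs by a constant from an indefinite integral
  over a bounded interval, which is continuous. Passing from \<open>{x - 1<..y}\<close> to
  \<open>{x - 1..y}\<close> changes only a null set.\<close>

lemma primitive_continuous:
  assumes "left_integrable g"
  shows "isCont (primitive g) x"
proof -
  have eq: "primitive g y = primitive g (x - 1) + integral {x - 1..y} g" if "y \<in> {x - 1..x + 1}" for y
  proof -
    have "set_integrable lebesgue {x - 1<..y} g"
      by (rule left_integrable_subset[OF assms, of _ y]) auto
    then have "(LINT t:{x - 1<..y}|lebesgue. g t) = integral {x - 1<..y} g"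
      by (rule set_lebesgue_integral_eq_integral)
    also have "\<dots> = integral {x - 1..y} g"
      by (rule integral_subset_negligible) (auto intro: negligible_subset[of "{x - 1}"])
    finally show ?thesis using primitive_split[OF assms, of "x - 1" y] that by simp
  qed
  have "g integrable_on {x - 1..x + 1}"
    by (intro set_lebesgue_integral_eq_integral(1) left_integrable_subset[OF assms, of _ "x + 1"]) auto
  then have "continuous_on {x - 1..x + 1} (\<lambda>y. primitive g (x - 1) + integral {x - 1..y} g)"
    by (intro continuous_intros indefinite_integral_continuous_1)
  then have "continuous_on {x - 1..x + 1} (primitive g)"
    by (rule continuous_on_eq) (rule eq[symmetric])
  then show ?thesis
    by (rule continuous_on_interior) simp
qed

text \<open>The integrals over \<open>{a..0}\<close> converge to the value at \<open>0\<close>, so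
  the remaining tail, which is the value at \<open>a\<close>, vanishes in the limit.\<close>

lemma primitive_at_bot:
  assumes "left_integrable g"
  shows "(primitive g \<longlongrightarrow> 0) at_bot"
proof -
  let ?b = "0::real"
  have "((\<lambda>a. LINT t:{a..?b}|lebesgue. g t) \<longlongrightarrow> primitive g ?b) at_bot"
    unfolding primitive_def
    by (rule tendsto_set_lebesgue_integral_at_bot) (auto intro: left_integrableD assms)
  then have "((\<lambda>a. primitive g ?b - (LINT t:{a..?b}|lebesgue. g t)) \<longlongrightarrow> primitive g ?b - primitive g ?b) at_bot"
    by (intro tendsto_intros)
  then have lim: "((\<lambda>a. primitive g ?b - (LINT t:{a..?b}|lebesgue. g t)) \<longlongrightarrow> 0) at_bot" by simp
  have "primitive g ?b - (LINT t:{a..?b}|lebesgue. g t) = primitive g a" if "a \<le> ?b" for a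
  proof -
    have "set_integrable lebesgue {a..?b} g" "set_integrable lebesgue {a<..?b} g"
      by (auto intro: left_integrable_subset[OF assms, of _ ?b])
    moreover have "integral {a<..?b} g = integral {a..?b} g"
      by (rule integral_subset_negligible) (auto intro: negligible_subset[of "{a}"])
    ultimately have "(LINT t:{a..?b}|lebesgue. g t) = (LINT t:{a<..?b}|lebesgue. g t)"
      by (simp add: set_lebesgue_integral_eq_integral)
    then show ?thesis using primitive_split[OF assms that] by simp
  qed
  then have "eventually (\<lambda>a. primitive g ?b - (LINT t:{a..?b}|lebesgue. g t) = primitive g a) at_bot"
    unfolding eventually_at_bot_linorder by blast
  with lim show ?thesis by (rule Lim_transform_eventually)
qed

lemma primitive_mono:
  fixes A :: "real \<Rightarrow> real"
  assumes "left_integrable A" "\<And>t. 0 \<le> A t" "x \<le> y"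
  shows "primitive A x \<le> primitive A y"
proof -
  have "0 \<le> (LINT t:{x<..y}|lebesgue. A t)"
    unfolding set_lebesgue_integral_def by (rule Bochner_Integration.integral_nonneg) (simp add: assms)
  then show ?thesis using primitive_split[OF assms(1,3)] by simp
qed

lemma primitive_nonneg:
  fixes A :: "real \<Rightarrow> real"
  assumes "\<And>t. 0 \<le> A t"
  shows "0 \<le> primitive A x"
  unfolding primitive_def set_lebesgue_integral_def by (rule Bochner_Integration.integral_nonneg) (simp add: assms)

lemma set_integral_norm_le:
  fixes h :: "real \<Rightarrow> 'a::euclidean_space"
  assumes "set_integrable lebesgue S h" "set_integrable lebesgue S q" "\<And>t. t \<in> S \<Longrightarrow> norm (h t) \<le> q t"
  shows "norm (LINT t:S|lebesgue. h t) \<le> (LINT t:S|lebesgue. q t)"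
proof -
  have "norm (LINT t:S|lebesgue. h t) \<le> (LINT t:S|lebesgue. norm (h t))"
    by (rule set_integral_norm_bound[OF assms(1)])
  also have "\<dots> \<le> (LINT t:S|lebesgue. q t)"
    using assms by (intro set_integral_mono set_integrable_norm) auto
  finally show ?thesis .
qed

text \<open>\<open>min\<close>, \<open>max\<close> and the absolute value cover both positions of
  \<open>y\<close> relative to \<open>x\<close>, as two-sided derivatives at \<open>x\<close>
  require.\<close>

lemma primitive_diff_bound:
  fixes h :: "real \<Rightarrow> 'a::euclidean_space"
  assumes h: "left_integrable h" and q: "left_integrable q" and B: "0 \<le> B"
    and le: "\<And>t. min x y \<le> t \<Longrightarrow> t \<le> max x y \<Longrightarrow> norm (h t) \<le> B * q t"
  shows "norm (primitive h y - primitive h x) \<le> B * \<bar>primitive q y - primitive q x\<bar>"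
proof -
  have *: "norm (primitive h y - primitive h x) \<le> B * (primitive q y - primitive q x)"
    if "x \<le> y" "\<And>t. x \<le> t \<Longrightarrow> t \<le> y \<Longrightarrow> norm (h t) \<le> B * q t" for x y
  proof -
    have "norm (LINT t:{x<..y}|lebesgue. h t) \<le> (LINT t:{x<..y}|lebesgue. B * q t)"
      using that by (intro set_integral_norm_le set_integrable_mult_right left_integrable_subset[OF h, of _ y]
        left_integrable_subset[OF q, of _ y]) auto
    then show ?thesis
      using primitive_split[OF h that(1)] primitive_split[OF q that(1)] by simp
  qed
  show ?thesis
  proof (cases "x \<le> y")
    case True
    have "norm (primitive h y - primitive h x) \<le> B * (primitive q y - primitive q x)"
      using True le by (intro *) auto
    moreover have "B * (primitive q y - primitive q x) \<le> B * \<bar>primitive q y - primitive q x\<bar>"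
      using B by (intro mult_left_mono) auto
    ultimately show ?thesis by linarith
  next
    case False
    have "norm (primitive h x - primitive h y) \<le> B * (primitive q x - primitive q y)"
      using False le by (intro *) auto
    moreover have "B * (primitive q x - primitive q y) \<le> B * \<bar>primitive q y - primitive q x\<bar>"
      using B by (intro mult_left_mono) auto
    ultimately show ?thesis by (simp add: norm_minus_commute)
  qed
qed

text \<open>\<open>M\<close> may vary with \<open>y\<close>: the bounds met later hold on left
  half-lines only and may deteriorate to the right.\<close>

lemma left_integrable_bound:
  fixes f :: "real \<Rightarrow> 'a::euclidean_space" and g :: "real \<Rightarrow> 'b::euclidean_space"
  assumes "left_integrable f" "g \<in> borel_measurable lebesgue"
    and "\<And>y. \<exists>M. \<forall>t\<le>y. norm (g t) \<le> M * norm (f t)"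
  shows "left_integrable g"
  unfolding left_integrable_def
proof
  fix y
  obtain M where M: "\<And>t. t \<le> y \<Longrightarrow> norm (g t) \<le> M * norm (f t)" using assms(3) by blast
  have "set_integrable lebesgue {..y} (\<lambda>t. M * norm (f t))"
    using left_integrableD[OF assms(1)] by (intro set_integrable_mult_right set_integrable_norm)
  then show "set_integrable lebesgue {..y} g"
  proof (rule set_integrable_bound)
    show "set_borel_measurable lebesgue {..y} g"
      unfolding set_borel_measurable_def
      by (intro borel_measurable_scaleR borel_measurable_indicator assms) auto
    show "AE t in lebesgue. t \<in> {..y} \<longrightarrow> norm (g t) \<le> norm (M * norm (f t))"
      using M by (force intro!: AE_I2)
  qed
qed

text \<open>By continuity of \<open>Q\<close> the bound is \<open>o(|y - x|)\<close>. With a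
  primitive as \<open>Q\<close>, this yields derivatives at every single point although the
  integrands are merely integrable.\<close>

lemma has_vector_derivative_zero_of_bound:
  fixes R :: "real \<Rightarrow> 'a::real_normed_vector"
  assumes "isCont Q x" "R x = 0"
    and "eventually (\<lambda>y. norm (R y) \<le> M * \<bar>y - x\<bar> * \<bar>Q y - Q x\<bar>) (at x)"
  shows "(R has_vector_derivative 0) (at x)"
proof -
  have "((\<lambda>y. M * \<bar>Q y - Q x\<bar>) \<longlongrightarrow> M * \<bar>Q x - Q x\<bar>) (at x)"
    using assms(1) unfolding isCont_def by (intro tendsto_intros)
  then have lim: "((\<lambda>y. M * \<bar>Q y - Q x\<bar>) \<longlongrightarrow> 0) (at x)" by simp
  have "eventually (\<lambda>y. norm (norm (R y - R x - (y - x) *\<^sub>R 0) / norm (y - x)) \<le> M * \<bar>Q y - Q x\<bar>) (at x)"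
    using assms(3) eventually_neq_at_within[of x x UNIV]
  proof eventually_elim
    case (elim y)
    then show ?case using assms(2) by (simp add: field_simps)
  qed
  then have "((\<lambda>y. norm (R y - R x - (y - x) *\<^sub>R 0) / norm (y - x)) \<longlongrightarrow> 0) (at x)"
    using lim by (rule Lim_null_comparison)
  then show ?thesis
    by (simp add: has_vector_derivative_def has_derivative_iff_norm)
qed

section \<open>Convolution with an exponential, and a bound for Neumann series\<close>

text \<open>Formally the solution of \<open>f' = c * f + g\<close> given by variation of constants
  from minus infinity. Keeping \<open>exp (c * x)\<close> outside the integral makes the dependence
  on \<open>x\<close> explicit.\<close>

definition exp_conv :: "complex \<Rightarrow> (real \<Rightarrow> complex) \<Rightarrow> real \<Rightarrow> complex" where
  "exp_conv c g x = exp (c * of_real x) * primitive (\<lambda>t. exp (- (c * of_real t)) * g t) x"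

text \<open>
  The input \<open>g\<close> is only locally integrable, so \<open>exp_conv c g\<close> need not be differentiable everywhere; subtracting the
  primitive of \<open>g\<close> makes the convolution kernel vanish on the diagonal, which removes the obstruction.
\<close>

lemma exp_conv_deriv:
  assumes g: "left_integrable g" and eg: "left_integrable (\<lambda>t. exp (- (c * of_real t)) * g t)"
  shows "((\<lambda>y. exp_conv c g y - primitive g y) has_vector_derivative c * exp_conv c g x) (at x)"
proof -
  let ?G = "primitive (\<lambda>t. exp (- (c * of_real t)) * g t)"
  let ?Q = "primitive (\<lambda>t. norm (g t))"
  \<comment> \<open>\<open>R y\<close> is the integral of
    \<open>(exp (c * (y - t)) - 1) * g t\<close> from \<open>x\<close> to \<open>y\<close>. What is
    left of the function to be differentiated is a multiple of an exponential in \<open>y\<close>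
    plus a constant.\<close>
  define R where "R y = exp (c * of_real y) * (?G y - ?G x) - (primitive g y - primitive g x)" for y
  let ?h = "\<lambda>y t. (exp (c * (of_real y - of_real t)) - 1) * g t"
  have hy: "left_integrable (?h y)"
    and Rh: "R y = primitive (?h y) y - primitive (?h y) x" for y
  proof -
    have eq: "?h y = (\<lambda>t. exp (c * of_real y) * (exp (- (c * of_real t)) * g t) - g t)"
      by (auto simp: fun_eq_iff algebra_simps exp_diff exp_minus divide_inverse)
    show "left_integrable (?h y)"
      unfolding eq left_integrable_def
      by (intro allI set_integral_diff set_integrable_mult_right left_integrableD eg g)
    have "primitive (?h y) x' = exp (c * of_real y) * ?G x' - primitive g x'" for x'
      unfolding eq primitive_def
      by (subst set_integral_diff) (auto intro!: set_integrable_mult_right left_integrableD eg g)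
    then show "R y = primitive (?h y) y - primitive (?h y) x"
      by (simp add: R_def right_diff_distrib)
  qed
  have "(R has_vector_derivative 0) (at x)"
  proof (rule has_vector_derivative_zero_of_bound)
    show "isCont ?Q x" by (intro primitive_continuous left_integrable_norm g)
    show "R x = 0" by (simp add: R_def)
    \<comment> \<open>This radius gives \<open>norm c * \<bar>y - x\<bar> \<le> 1/2\<close>, the
      range in which \<open>exp - 1\<close> is bounded by 3/2 times the modulus of its argument;
      adding 1 to \<open>norm c\<close> covers \<open>c = 0\<close>.\<close>
    have "eventually (\<lambda>y. dist y x < 1 / (2 * (norm c + 1))) (at x)"
      by (intro eventually_at_ball[where A=UNIV, THEN eventually_mono]) (auto simp: dist_commute add_nonneg_pos)
    then show "eventually (\<lambda>y. norm (R y) \<le> (3 / 2 * norm c) * \<bar>y - x\<bar> * \<bar>?Q y - ?Q x\<bar>) (at x)"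
    proof eventually_elim
      case (elim y)
      have y: "norm c * \<bar>y - x\<bar> \<le> 1/2"
      proof -
        have "norm c * \<bar>y - x\<bar> \<le> (norm c + 1) * \<bar>y - x\<bar>" by (simp add: mult_right_mono)
        also have "\<dots> \<le> (norm c + 1) * (1 / (2 * (norm c + 1)))"
          using elim by (intro mult_left_mono) (auto simp: dist_real_def)
        also have "\<dots> = 1/2" using norm_ge_zero[of c] by (simp add: field_simps del: norm_ge_zero)
        finally show ?thesis .
      qed
      show ?case unfolding Rh
      proof (rule primitive_diff_bound[OF hy left_integrable_norm[OF g]])
        show "0 \<le> 3 / 2 * norm c * \<bar>y - x\<bar>" by simp
      next
        fix t assume t: "min x y \<le> t" "t \<le> max x y"
        then have le: "\<bar>y - t\<bar> \<le> \<bar>y - x\<bar>" by auto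
        have n: "norm (c * (of_real y - of_real t)) = norm c * \<bar>y - t\<bar>"
          by (simp add: norm_mult flip: of_real_diff)
        also have "\<dots> \<le> norm c * \<bar>y - x\<bar>" using le by (simp add: mult_left_mono)
        finally have nle: "norm (c * (of_real y - of_real t)) \<le> norm c * \<bar>y - x\<bar>" .
        have "norm (exp (c * (of_real y - of_real t)) - 1) \<le> 3 / 2 * norm (c * (of_real y - of_real t))"
          using nle y by (intro norm_exp_bounds(2)) linarith
        also have "\<dots> \<le> 3 / 2 * norm c * \<bar>y - x\<bar>" using nle by simp
        finally show "norm ((exp (c * (of_real y - of_real t)) - 1) * g t) \<le> 3 / 2 * norm c * \<bar>y - x\<bar> * norm (g t)"
          unfolding norm_mult by (rule mult_right_mono) simp
      qed
    qed
  qed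
  moreover have "((\<lambda>y. exp (c * of_real y) * ?G x - primitive g x) has_vector_derivative c * exp_conv c g x) (at x)"
    unfolding exp_conv_def
    by (auto intro!: derivative_eq_intros has_vector_derivative_real_field)
  ultimately have "((\<lambda>y. R y + (exp (c * of_real y) * ?G x - primitive g x)) has_vector_derivative
      0 + c * exp_conv c g x) (at x)"
    by (rule has_vector_derivative_add)
  then show ?thesis
    by (simp add: R_def exp_conv_def algebra_simps)
qed

text \<open>
  The constant \<open>C\<close> grows with \<open>y\<close>: an interval on which \<open>A\<close> has integral at most \<open>1/4\<close> can be appended
  at the cost of enlarging \<open>C\<close>, and finitely many such intervals lead to any \<open>y\<close>.
\<close>

lemma neumann_bound:
  fixes A :: "real \<Rightarrow> real" and f :: "nat \<Rightarrow> real \<Rightarrow> real"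
  assumes A: "left_integrable A" "\<And>t. 0 \<le> A t" and A_meas: "A \<in> borel_measurable lebesgue"
    and f: "\<And>n. f n \<in> borel_measurable lebesgue" "\<And>n x. 0 \<le> f n x" "\<And>x. f 0 x \<le> 1"
    and f_Suc: "\<And>n x. f (Suc n) x \<le> primitive (\<lambda>t. A t * f n t) x"
  shows "\<exists>C. \<forall>n. \<forall>x\<le>y. f n x \<le> C * (1/2)^n"
proof -
  define Bd where "Bd y \<longleftrightarrow> (\<exists>C. \<forall>n. \<forall>x\<le>y. f n x \<le> C * (1/2)^n)" for y
  \<comment> \<open>Integrability must be settled before integrals are compared, since a
    non-integrable function has integral 0 by default.\<close>
  have int: "set_integrable lebesgue {..b} (\<lambda>t. A t * f n t)"
    if "\<And>x. x \<le> b \<Longrightarrow> f n x \<le> K" for n b K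
  proof (rule set_integrable_bound)
    show "set_integrable lebesgue {..b} (\<lambda>t. A t * K)"
      using A left_integrableD by (intro set_integrable_mult_left) auto
    show "set_borel_measurable lebesgue {..b} (\<lambda>t. A t * f n t)"
      unfolding set_borel_measurable_def
      by (intro borel_measurable_scaleR borel_measurable_indicator borel_measurable_times f A_meas) auto
    show "AE t in lebesgue. t \<in> {..b} \<longrightarrow> norm (A t * f n t) \<le> norm (A t * K)"
      using that f(2) A(2)
      by (intro AE_I2) (auto simp: abs_mult intro!: mult_left_mono order_trans[OF that])
  qed
  have step: "Bd b" if "a \<le> b" "Bd a" and small: "primitive A b - primitive A a \<le> 1/4" for a b
  proof -
    obtain C where C: "\<And>n x. x \<le> a \<Longrightarrow> f n x \<le> C * (1/2)^n" using \<open>Bd a\<close> by (auto simp: Bd_def)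
    have C0: "0 \<le> C" using C[of a 0] f(2)[of 0 a] by simp
    \<comment> \<open>The first summand absorbs the contribution of \<open>{..a}\<close>, so that
      \<open>primitive A a * C + C' / 4 \<le> C' / 2\<close>. The other two give
      \<open>C \<le> C'\<close> and \<open>1 \<le> C'\<close>, the latter for the zeroth
      term.\<close>
    define C' where "C' = 4 * C * primitive A a + C + 1"
    have Qa: "0 \<le> primitive A a" by (intro primitive_nonneg A)
    have CC': "C \<le> C'" "1 \<le> C'" using C0 Qa by (auto simp: C'_def)
    have "f n x \<le> C' * (1/2)^n" if "x \<le> b" for n x
      using that
    proof (induction n arbitrary: x)
      case 0
      then show ?case using f(3)[of x] CC' by simp
    next
      case (Suc n)
      show ?case
      proof (cases "x \<le> a")
        case True
        then have "f (Suc n) x \<le> C * (1/2)^Suc n" by (rule C)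
        also have "\<dots> \<le> C' * (1/2)^Suc n" using CC' by (intro mult_right_mono) auto
        finally show ?thesis .
      next
        case False
        have i: "set_integrable lebesgue {..x} (\<lambda>t. A t * f n t)"
          using Suc by (intro int[where K="C' * (1/2)^n"]) auto
        have ia: "set_integrable lebesgue {..a} (\<lambda>t. A t * f n t)"
          by (rule set_integrable_subset[OF i]) (use False in auto)
        have ib: "set_integrable lebesgue {a<..x} (\<lambda>t. A t * f n t)"
          by (rule set_integrable_subset[OF i]) (use False in auto)
        have Aa: "set_integrable lebesgue {..a} A" and Ax: "set_integrable lebesgue {a<..x} A"
          by (auto intro: left_integrable_subset[OF A(1), of _ x] left_integrableD[OF A(1)])
        have "{..x} = {..a} \<union> {a<..x}" using False by auto
        then have "primitive (\<lambda>t. A t * f n t) x = (LINT t:{..a}|lebesgue. A t * f n t) + (LINT t:{a<..x}|lebesgue. A t * f n t)"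
          unfolding primitive_def using ia ib
          by (simp, intro set_integral_Un) auto
        also have "\<dots> \<le> (LINT t:{..a}|lebesgue. A t * (C * (1/2)^n)) + (LINT t:{a<..x}|lebesgue. A t * (C' * (1/2)^n))"
          using ia ib Aa Ax C Suc A
          by (intro add_mono set_integral_mono set_integrable_mult_left mult_left_mono) auto
        also have "\<dots> = primitive A a * (C * (1/2)^n) + (primitive A x - primitive A a) * (C' * (1/2)^n)"
          using primitive_split[OF A(1), of a x] False by (simp add: primitive_def)
        also have "\<dots> \<le> primitive A a * (C * (1/2)^n) + (1/4) * (C' * (1/2)^n)"
          using primitive_mono[OF A Suc.prems] small CC' C0 by (intro add_mono mult_right_mono) auto
        also have "\<dots> = (primitive A a * C + C' / 4) * (1/2)^n" by (simp add: algebra_simps)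
        also have "\<dots> \<le> (C' / 2) * (1/2)^n"
          using C0 CC' by (intro mult_right_mono) (auto simp: C'_def)
        finally show ?thesis using f_Suc[of n x] by simp
      qed
    qed
    then show ?thesis unfolding Bd_def by blast
  qed
  \<comment> \<open>Far enough to the left \<open>A\<close> has integral below 1/4, hence each
    iteration at least halves the bound and the constant 1 works.\<close>
  have "eventually (\<lambda>a. primitive A a < 1/4) at_bot"
    using primitive_at_bot[OF A(1)] by (rule order_tendstoD) simp
  then obtain N where "\<And>a. a \<le> N \<Longrightarrow> primitive A a < 1/4"
    unfolding eventually_at_bot_linorder by blast
  then obtain a where a: "primitive A a < 1/4" "a \<le> y"
    using min.cobounded1[of N y] min.cobounded2[of N y] by blast
  have "Bd a"
    unfolding Bd_def
  proof (intro exI[of _ 1] allI impI)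
    fix n x assume "x \<le> a"
    then show "f n x \<le> 1 * (1/2)^n"
    proof (induction n arbitrary: x)
      case (Suc n)
      have i: "set_integrable lebesgue {..x} (\<lambda>t. A t * f n t)"
        using Suc by (intro int[where K="(1/2)^n"]) auto
      have "primitive (\<lambda>t. A t * f n t) x \<le> (LINT t:{..x}|lebesgue. A t * (1/2)^n)"
        unfolding primitive_def using i Suc A left_integrableD[OF A(1)]
        by (intro set_integral_mono set_integrable_mult_left mult_left_mono) auto
      also have "\<dots> = primitive A x * (1/2)^n" by (simp add: primitive_def)
      also have "\<dots> \<le> 1/2 * (1/2)^n"
        using a primitive_mono[OF A Suc.prems] by (intro mult_right_mono) auto
      finally show ?case using f_Suc[of n x] by simp
    qed (use f in auto)
  qed
  \<comment> \<open>Bisection: it suffices that \<open>Bd\<close> passes from left to right end of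
    every short interval around a given point. Oscillation below 1/8 on either side of
    \<open>x\<close> keeps the integral of \<open>A\<close> within the 1/4 that \<open>step\<close>
    allows.\<close>
  have "Bd a \<longrightarrow> Bd y"
    using a(2)
  proof (induction rule: Bolzano)
    case (local x)
    have "isCont (primitive A) x" by (rule primitive_continuous[OF A(1)])
    then obtain d where d: "d > 0" "\<And>y. \<bar>y - x\<bar> < d \<Longrightarrow> \<bar>primitive A y - primitive A x\<bar> < 1/8"
      unfolding continuous_at_real_range by (metis zero_less_divide_1_iff zero_less_numeral real_norm_def)
    show ?case
    proof (intro exI[of _ d] conjI d allI impI)
      fix a b assume ab: "a \<le> x \<and> x \<le> b \<and> b - a < d" "Bd a"
      then have "\<bar>primitive A a - primitive A x\<bar> < 1/8" "\<bar>primitive A b - primitive A x\<bar> < 1/8"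
        using ab by (intro d; simp)+
      then have "primitive A b - primitive A a \<le> 1/4" by linarith
      then show "Bd b" using ab by (intro step[of a b]) auto
    qed
  qed auto
  then show ?thesis using \<open>Bd a\<close> by (simp add: Bd_def)
qed

section \<open>Cube roots of unity and the exponents in the sector\<close>

lemma zeta_sum: "zeta1 + zeta2 = -1"
  by (simp add: zeta1_def zeta2_def field_simps)

lemma zeta_mult: "zeta1 * zeta2 = 1"
  by (simp add: zeta1_def zeta2_def complex_eq_iff field_simps)

lemma zeta_squares: "zeta1 * zeta1 = zeta2" "zeta2 * zeta2 = zeta1"
  by (simp_all add: zeta1_def zeta2_def complex_eq_iff field_simps)

text \<open>The coefficients in \<open>s2\<close> thereby become the roots themselves, and each
  differentiation multiplies them by the same root once more.\<close>

lemma zeta_inverse_squares: "inverse (zeta1 ^ 2) = zeta1" "inverse (zeta2 ^ 2) = zeta2"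
  by (rule inverse_unique; simp add: power2_eq_square zeta_squares zeta_mult mult.commute)+

lemma Omega0_minus_iff: "w \<in> Omega0_minus \<longleftrightarrow> \<bar>Re w\<bar> < - (sqrt 3 * Im w)"
  by (simp add: Omega0_minus_def Omega0_def)

text \<open>Of the three characteristic exponents, \<open>\<i> * z\<close> is the one with the
  largest real part, so its exponential decays fastest at minus infinity. The comparisons are the
  sector inequality multiplied by \<open>sqrt 3\<close>.\<close>

lemma Omega0_minus_exponents:
  assumes "z \<in> Omega0_minus"
  shows "0 < Re (\<i> * z)" "Re (\<i> * z * zeta1) \<le> Re (\<i> * z)" "Re (\<i> * z * zeta2) \<le> Re (\<i> * z)"
proof -
  define s where "s = sqrt 3"
  have s: "s * s = 3" "0 < s" by (simp_all add: s_def)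
  have z: "\<bar>Re z\<bar> < s * (- Im z)" using assms by (simp add: Omega0_minus_iff s_def)
  then have "0 < s * (- Im z)" by linarith
  then show "0 < Re (\<i> * z)" using s by (simp add: zero_less_mult_iff mult_less_0_iff)
  have "s * \<bar>Re z\<bar> \<le> s * (s * (- Im z))" using z s(2) by (intro mult_left_mono) auto
  also have "\<dots> = - 3 * Im z" using s(1) by (simp flip: mult.assoc)
  finally have "\<bar>s * Re z\<bar> \<le> - 3 * Im z" using s(2) by (simp add: abs_mult)
  then show "Re (\<i> * z * zeta1) \<le> Re (\<i> * z)" "Re (\<i> * z * zeta2) \<le> Re (\<i> * z)"
    by (simp_all add: zeta1_def zeta2_def s_def algebra_simps add_divide_distrib diff_divide_distrib abs_le_iff)
qed

lemma zpar_Omega0_minus: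
  assumes "0 < c" "w \<in> Omega0_minus"
  shows "zpar c w \<in> Omega0_minus"
proof -
  have r: "0 < root 3 c" using assms by simp
  have "\<bar>Re w\<bar> * root 3 c < - (sqrt 3 * Im w) * root 3 c"
    using assms(2) r unfolding Omega0_minus_iff by (rule mult_strict_right_mono)
  then show ?thesis using r by (simp add: Omega0_minus_iff zpar_def abs_mult)
qed

section \<open>The Volterra operator at minus infinity\<close>

text \<open>The class in which the Neumann iterates live: uniform bounds on each left half-line, no
  control at plus infinity, and measurability so that products with the potential can be
  integrated.\<close>

definition left_bounded :: "(real \<Rightarrow> complex) \<Rightarrow> bool" where
  "left_bounded f \<longleftrightarrow> f \<in> borel_measurable lebesgue \<and> (\<forall>y. \<exists>M. \<forall>t\<le>y. norm (f t) \<le> M)"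

lemma borel_measurable_lebesgue_continuous:
  fixes f :: "real \<Rightarrow> complex"
  assumes "\<And>x. isCont f x"
  shows "f \<in> borel_measurable lebesgue"
proof -
  have "f \<in> borel_measurable borel"
    by (intro borel_measurable_continuous_onI continuous_at_imp_continuous_on ballI assms)
  then show ?thesis by (simp add: measurable_completion)
qed

text \<open>Only solutions normalised at minus infinity are treated here. Those at plus infinity
  come from a second interpretation, with reflected coefficient.\<close>

locale left_jost =
  fixes m :: "real \<Rightarrow> real" and c :: real and w :: complex
  assumes c: "0 < c" and w: "w \<in> Omega0_minus"
    and m_meas: "m \<in> borel_measurable lebesgue"
    and q_int: "left_integrable (\<lambda>t. m t / c - 1)"
begin

definition z :: complex where "z = zpar c w"
definition q :: "real \<Rightarrow> real" where "q t = m t / c - 1"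
text \<open>For the Jost solution \<open>f = phi\<close> this is \<open>q * u\<close>, the
  perturbation in \<open>u''' = (\<i> * z) ^ 3 * (1 + q) * u\<close>, which is the equation in
  normalised form.\<close>

definition weight :: "(real \<Rightarrow> complex) \<Rightarrow> real \<Rightarrow> complex" where
  "weight f t = of_real (q t) * (exp (\<i> * z * of_real t) * f t)"
definition kernel :: "real \<Rightarrow> real \<Rightarrow> complex" where
  "kernel x t = exp (\<i> * z * of_real (t - x)) * s2 (\<i> * z * of_real (x - t))"
definition volterra :: "(real \<Rightarrow> complex) \<Rightarrow> real \<Rightarrow> complex" where
  "volterra f x = \<i> * z * (LINT t:{..x}|lebesgue. kernel x t * of_real (q t) * f t)"

lemma z_sector: "z \<in> Omega0_minus"
  unfolding z_def by (rule zpar_Omega0_minus[OF c w])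

lemmas exponents = Omega0_minus_exponents[OF z_sector]

lemma q_meas: "q \<in> borel_measurable lebesgue"
  unfolding q_def using m_meas by measurable

lemma q_left_integrable: "left_integrable q"
  using q_int by (simp add: q_def[abs_def])

lemma phi0_term_Suc: "phi0_term m c w (Suc n) = volterra (phi0_term m c w n)"
  by (simp add: volterra_def kernel_def q_def z_def fun_eq_iff)

text \<open>Separates \<open>x\<close> from \<open>t\<close>, so that the integral splits into three
  exponential convolutions; the last factor is the one contained in \<open>weight\<close>.\<close>

lemma kernel_eq:
  "kernel x t = exp (- (\<i> * z * of_real x)) * (1/3) *
    (exp (\<i> * z * of_real x) * exp (- (\<i> * z * of_real t))
     + zeta1 * exp (\<i> * z * zeta1 * of_real x) * exp (- (\<i> * z * zeta1 * of_real t))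
     + zeta2 * exp (\<i> * z * zeta2 * of_real x) * exp (- (\<i> * z * zeta2 * of_real t))) * exp (\<i> * z * of_real t)"
proof -
  have e: "exp (\<zeta> * (\<i> * z * of_real (x - t))) = exp (\<i> * z * \<zeta> * of_real x) * exp (- (\<i> * z * \<zeta> * of_real t))" for \<zeta>
    unfolding mult_exp_exp by (rule arg_cong[where f=exp]) (simp add: algebra_simps)
  have "exp (\<i> * z * of_real (t - x)) = exp (- (\<i> * z * of_real x)) * exp (\<i> * z * of_real t)"
    unfolding mult_exp_exp by (rule arg_cong[where f=exp]) (simp add: algebra_simps)
  then show ?thesis
    using e[of 1] e[of zeta1] e[of zeta2]
    by (simp add: kernel_def s2_def zeta_inverse_squares mult_ac)
qed

text \<open>The factor \<open>exp (\<i> * z * (t - x))\<close> compensates the dominant exponential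
  of \<open>s2\<close>. Three terms of modulus at most 1, divided by 3, remain.\<close>

lemma norm_kernel_le:
  assumes "t \<le> x"
  shows "norm (kernel x t) \<le> 1"
proof -
  have *: "norm (exp (\<zeta> * (\<i> * z * of_real (x - t)) - \<i> * z * of_real (x - t))) \<le> 1"
    if "Re (\<i> * z * \<zeta>) \<le> Re (\<i> * z)" for \<zeta>
  proof -
    have "Re (\<zeta> * (\<i> * z * of_real (x - t)) - \<i> * z * of_real (x - t)) = (Re (\<i> * z * \<zeta>) - Re (\<i> * z)) * (x - t)"
      by (simp add: algebra_simps)
    also have "\<dots> \<le> 0" using that assms by (intro mult_nonpos_nonneg) auto
    finally show ?thesis by (simp only: norm_exp_eq_Re exp_le_one_iff)
  qed
  have n: "norm zeta1 = 1" "norm zeta2 = 1"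
    by (simp_all add: zeta1_def zeta2_def cmod_def power2_eq_square field_simps)
  have "kernel x t = (1 + zeta1 * exp (zeta1 * (\<i> * z * of_real (x - t)) - \<i> * z * of_real (x - t))
      + zeta2 * exp (zeta2 * (\<i> * z * of_real (x - t)) - \<i> * z * of_real (x - t))) / 3"
    by (simp add: kernel_def s2_def zeta_inverse_squares exp_add[symmetric] algebra_simps)
  also have "norm \<dots> \<le> (1 + 1 * 1 + 1 * 1) / 3"
    using *[OF exponents(2)] *[OF exponents(3)]
    by (simp only: norm_divide norm_numeral, intro divide_right_mono norm_triangle_le add_mono)
      (simp_all add: norm_mult n)
  finally show ?thesis by simp
qed

lemma weight_meas:
  assumes "f \<in> borel_measurable lebesgue"
  shows "weight f \<in> borel_measurable lebesgue"
proof -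
  have "(\<lambda>t. exp (\<i> * z * of_real t)) \<in> borel_measurable lebesgue"
    by (intro borel_measurable_lebesgue_continuous continuous_intros)
  then show ?thesis
    unfolding weight_def using assms q_meas by measurable
qed

text \<open>The combined exponential has modulus \<open>exp ((Re (\<i> * z) - Re e) * t)\<close>,
  which is nondecreasing in \<open>t\<close> and thus bounded on \<open>{..y}\<close> by its value
  at \<open>y\<close>.\<close>

lemma exp_weight_left_integrable:
  assumes f: "left_bounded f" and e: "Re e \<le> Re (\<i> * z)"
  shows "left_integrable (\<lambda>t. exp (- (e * of_real t)) * weight f t)"
proof (rule left_integrable_bound[OF q_left_integrable])
  have "(\<lambda>t. exp (- (e * of_real t))) \<in> borel_measurable lebesgue"
    by (intro borel_measurable_lebesgue_continuous continuous_intros)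
  moreover have "weight f \<in> borel_measurable lebesgue"
    using f by (intro weight_meas) (simp add: left_bounded_def)
  ultimately show "(\<lambda>t. exp (- (e * of_real t)) * weight f t) \<in> borel_measurable lebesgue"
    by measurable
  fix y
  obtain M where M: "\<And>t. t \<le> y \<Longrightarrow> norm (f t) \<le> M" using f by (auto simp: left_bounded_def)
  show "\<exists>M. \<forall>t\<le>y. norm (exp (- (e * of_real t)) * weight f t) \<le> M * norm (q t)"
  proof (intro exI allI impI)
    fix t assume t: "t \<le> y"
    have "norm (exp (- (e * of_real t)) * exp (\<i> * z * of_real t)) = exp ((Re (\<i> * z) - Re e) * t)"
      by (simp add: exp_add[symmetric] norm_mult norm_exp_eq_Re algebra_simps)
    also have "\<dots> \<le> exp ((Re (\<i> * z) - Re e) * y)"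
      using t e by (simp add: mult_left_mono)
    finally have "norm (exp (- (e * of_real t)) * exp (\<i> * z * of_real t)) * norm (f t) \<le>
      exp ((Re (\<i> * z) - Re e) * y) * M"
      using M[OF t] by (intro mult_mono) auto
    then have "norm (exp (- (e * of_real t)) * exp (\<i> * z * of_real t)) * norm (f t) * \<bar>q t\<bar> \<le>
      exp ((Re (\<i> * z) - Re e) * y) * M * \<bar>q t\<bar>"
      by (intro mult_right_mono) auto
    then show "norm (exp (- (e * of_real t)) * weight f t) \<le> exp ((Re (\<i> * z) - Re e) * y) * M * norm (q t)"
      by (simp add: weight_def norm_mult algebra_simps)
  qed
qed

lemma weight_left_integrable:
  assumes "left_bounded f"
  shows "left_integrable (weight f)"
  using exp_weight_left_integrable[OF assms, of 0] exponents(1) by simp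

abbreviation conv :: "complex \<Rightarrow> (real \<Rightarrow> complex) \<Rightarrow> real \<Rightarrow> complex" where
  "conv \<zeta> f \<equiv> exp_conv (\<i> * z * \<zeta>) (weight f)"

lemma
  assumes "left_bounded f"
  shows volterra_integrable: "left_integrable (\<lambda>t. kernel x t * of_real (q t) * f t)"
    and volterra_eq: "exp (\<i> * z * of_real x) * volterra f x =
      \<i> * z / 3 * (conv 1 f x + zeta1 * conv zeta1 f x + zeta2 * conv zeta2 f x)"
proof -
  let ?e = "\<lambda>\<zeta>. exp (\<i> * z * \<zeta> * of_real x)"
  let ?h = "\<lambda>\<zeta> t. exp (- (\<i> * z * \<zeta> * of_real t)) * weight f t"
  have int: "left_integrable (?h 1)" "left_integrable (?h zeta1)" "left_integrable (?h zeta2)"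
    by (intro exp_weight_left_integrable assms exponents; simp)+
  have eq: "(\<lambda>t. kernel x t * of_real (q t) * f t) = (\<lambda>t. exp (- (\<i> * z * of_real x)) * (1/3) *
      (?e 1 * ?h 1 t + zeta1 * ?e zeta1 * ?h zeta1 t + zeta2 * ?e zeta2 * ?h zeta2 t))"
    unfolding kernel_eq weight_def by (simp add: fun_eq_iff algebra_simps)
  show "left_integrable (\<lambda>t. kernel x t * of_real (q t) * f t)"
    unfolding eq left_integrable_def
    by (intro allI set_integrable_mult_right set_integral_add(1) left_integrableD int)
  have L: "(LINT t:{..x}|lebesgue. kernel x t * of_real (q t) * f t) = exp (- (\<i> * z * of_real x)) * (1/3) *
      (?e 1 * primitive (?h 1) x + zeta1 * ?e zeta1 * primitive (?h zeta1) x + zeta2 * ?e zeta2 * primitive (?h zeta2) x)"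
    unfolding eq primitive_def
    by (simp only: set_integral_mult_right set_integral_add set_integrable_mult_right left_integrableD int)
  \<comment> \<open>Stated for free variables, so that \<open>algebra\<close> does not meet the
    exponentials; \<open>a\<close> and \<open>b\<close> stand for the two mutually inverse
    ones.\<close>
  have *: "a * (i * (b * (1/3) * S)) = i / 3 * S" if "a * b = 1" for a b i S :: complex
    using that by algebra
  have "exp (\<i> * z * of_real x) * exp (- (\<i> * z * of_real x)) = 1"
    by (simp add: exp_minus)
  then show "exp (\<i> * z * of_real x) * volterra f x =
      \<i> * z / 3 * (conv 1 f x + zeta1 * conv zeta1 f x + zeta2 * conv zeta2 f x)"
    unfolding volterra_def L exp_conv_def mult.assoc[of zeta1] mult.assoc[of zeta2] by (rule *)
qed

lemma conv_continuous:
  assumes "left_bounded f" "Re (\<i> * z * \<zeta>) \<le> Re (\<i> * z)"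
  shows "isCont (conv \<zeta> f) x"
  unfolding exp_conv_def
  by (intro continuous_intros primitive_continuous exp_weight_left_integrable assms)

text \<open>The kernel is bounded by 1. The right-hand side has the shape that
  \<open>neumann_bound\<close> asks for, with \<open>A t = norm z * \<bar>q t\<bar>\<close>.\<close>

lemma volterra_bound:
  assumes "left_bounded f"
  shows "norm (volterra f x) \<le> primitive (\<lambda>t. norm z * \<bar>q t\<bar> * norm (f t)) x"
proof -
  have "left_integrable (\<lambda>t. \<bar>q t\<bar> * norm (f t))"
  proof (rule left_integrable_bound[OF q_left_integrable])
    show "(\<lambda>t. \<bar>q t\<bar> * norm (f t)) \<in> borel_measurable lebesgue"
      using assms q_meas by (intro borel_measurable_times borel_measurable_abs borel_measurable_norm) (auto simp: left_bounded_def)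
    fix y
    obtain M where "\<And>t. t \<le> y \<Longrightarrow> norm (f t) \<le> M" using assms by (auto simp: left_bounded_def)
    then show "\<exists>M. \<forall>t\<le>y. norm (\<bar>q t\<bar> * norm (f t)) \<le> M * norm (q t)"
      by (intro exI[of _ M]) (auto simp: abs_mult mult.commute intro!: mult_right_mono)
  qed
  then have "norm (LINT t:{..x}|lebesgue. kernel x t * of_real (q t) * f t) \<le> primitive (\<lambda>t. \<bar>q t\<bar> * norm (f t)) x"
    unfolding primitive_def
    by (intro set_integral_norm_le left_integrableD volterra_integrable assms)
      (auto simp: norm_mult mult.assoc intro!: mult_left_le_one_le norm_kernel_le)
  then have "norm (volterra f x) \<le> norm z * primitive (\<lambda>t. \<bar>q t\<bar> * norm (f t)) x"
    unfolding volterra_def by (simp add: norm_mult mult_left_mono)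
  then show ?thesis by (simp add: primitive_def mult.assoc)
qed

lemma left_bounded_volterra:
  assumes "left_bounded f"
  shows "left_bounded (volterra f)"
  unfolding left_bounded_def
proof (intro conjI allI)
  \<comment> \<open>Measurability is obtained from continuity, which the representation by
    convolutions makes visible.\<close>
  have "volterra f = (\<lambda>x. exp (- (\<i> * z * of_real x)) *
      (\<i> * z / 3 * (conv 1 f x + zeta1 * conv zeta1 f x + zeta2 * conv zeta2 f x)))"
    using volterra_eq[OF assms] by (auto simp: fun_eq_iff exp_minus field_simps)
  moreover have "isCont \<dots> x" for x
    by (intro continuous_intros conv_continuous assms exponents; simp)
  ultimately show "volterra f \<in> borel_measurable lebesgue"
    by (metis borel_measurable_lebesgue_continuous)
  fix y
  obtain M where M: "\<And>t. t \<le> y \<Longrightarrow> norm (f t) \<le> M" using assms by (auto simp: left_bounded_def)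
  have A: "left_integrable (\<lambda>t. norm z * \<bar>q t\<bar>)"
    using left_integrable_norm[OF q_left_integrable] by (auto simp: left_integrable_def)
  have "norm (volterra f x) \<le> primitive (\<lambda>t. norm z * \<bar>q t\<bar>) y * \<bar>M\<bar>" if "x \<le> y" for x
  proof -
    have bnd: "norm z * \<bar>q t\<bar> * norm (f t) \<le> norm z * \<bar>q t\<bar> * \<bar>M\<bar>" if "t \<le> x" for t
      using M[of t] that \<open>x \<le> y\<close> by (intro mult_left_mono) auto
    have i1: "set_integrable lebesgue {..x} (\<lambda>t. norm z * \<bar>q t\<bar> * \<bar>M\<bar>)"
      using left_integrableD[OF A] by (intro set_integrable_mult_left)
    have "set_borel_measurable lebesgue {..x} (\<lambda>t. norm z * \<bar>q t\<bar> * norm (f t))"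
      unfolding set_borel_measurable_def using assms q_meas
      by (intro borel_measurable_scaleR borel_measurable_indicator borel_measurable_times) (auto simp: left_bounded_def)
    then have "set_integrable lebesgue {..x} (\<lambda>t. norm z * \<bar>q t\<bar> * norm (f t))"
      using i1 bnd by (intro set_integrable_bound[OF i1]) (auto simp: abs_mult)
    then have "primitive (\<lambda>t. norm z * \<bar>q t\<bar> * norm (f t)) x \<le> primitive (\<lambda>t. norm z * \<bar>q t\<bar> * \<bar>M\<bar>) x"
      unfolding primitive_def by (intro set_integral_mono i1 bnd) auto
    also have "\<dots> = primitive (\<lambda>t. norm z * \<bar>q t\<bar>) x * \<bar>M\<bar>" by (simp only: primitive_def set_integral_mult_left)
    also have "\<dots> \<le> primitive (\<lambda>t. norm z * \<bar>q t\<bar>) y * \<bar>M\<bar>"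
      using that by (intro mult_right_mono primitive_mono A) auto
    finally show ?thesis using volterra_bound[OF assms, of x] by linarith
  qed
  then show "\<exists>M. \<forall>t\<le>y. norm (volterra f t) \<le> M" by blast
qed

section \<open>The Neumann series and the integral equation\<close>

abbreviation phi_n where "phi_n n \<equiv> phi0_term m c w n"
definition phi :: "real \<Rightarrow> complex" where "phi = phi0 m c w"

lemma phi_n_left_bounded: "left_bounded (phi_n n)"
proof (induction n)
  case 0
  show ?case by (auto simp: left_bounded_def)
next
  case (Suc n)
  then show ?case unfolding phi0_term_Suc by (rule left_bounded_volterra)
qed

lemma phi_n_bound: "\<exists>C. \<forall>n. \<forall>x\<le>y. norm (phi_n n x) \<le> C * (1/2)^n"
proof (rule neumann_bound)
  show "left_integrable (\<lambda>t. norm z * \<bar>q t\<bar>)"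
    using left_integrable_norm[OF q_left_integrable] by (auto simp: left_integrable_def)
  show "(\<lambda>t. norm z * \<bar>q t\<bar>) \<in> borel_measurable lebesgue"
    using q_meas by measurable
  show "(\<lambda>x. norm (phi_n n x)) \<in> borel_measurable lebesgue" for n
  proof -
    have "phi_n n \<in> borel_measurable lebesgue" using phi_n_left_bounded[of n] by (simp add: left_bounded_def)
    then show ?thesis by measurable
  qed
  show "norm (phi_n (Suc n) x) \<le> primitive (\<lambda>t. norm z * \<bar>q t\<bar> * norm (phi_n n t)) x" for n x
    unfolding phi0_term_Suc by (rule volterra_bound[OF phi_n_left_bounded])
qed auto

lemma phi_n_summable: "summable (\<lambda>n. norm (phi_n n x))"
proof -
  obtain C where "\<forall>n. \<forall>t\<le>x. norm (phi_n n t) \<le> C * (1/2)^n" using phi_n_bound[of x] by blast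
  then have le: "\<And>n. norm (phi_n n x) \<le> C * (1/2)^n" by simp
  have "summable (\<lambda>n. C * (1/2)^n)" by (intro summable_mult summable_geometric) simp
  then show ?thesis
    by (rule summable_comparison_test'[where N=0]) (simp only: real_norm_def abs_norm_cancel le)
qed

lemma phi_left_bounded: "left_bounded phi"
  unfolding left_bounded_def
proof (intro conjI allI)
  have "(\<lambda>x. \<Sum>n. phi_n n x) \<in> borel_measurable lebesgue"
    using phi_n_left_bounded by (intro borel_measurable_suminf) (auto simp: left_bounded_def)
  then show "phi \<in> borel_measurable lebesgue" by (simp add: phi_def phi0_def[abs_def])
  fix y
  obtain C where C: "\<And>n x. x \<le> y \<Longrightarrow> norm (phi_n n x) \<le> C * (1/2)^n" using phi_n_bound[of y] by blast
  have "norm (phi x) \<le> (\<Sum>n. C * (1/2)^n)" if "x \<le> y" for x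
    unfolding phi_def phi0_def
    by (intro norm_suminf_le C that summable_mult summable_geometric) simp
  then show "\<exists>M. \<forall>t\<le>y. norm (phi t) \<le> M" by blast
qed

text \<open>Summing the recursion over \<open>n\<close> gives the equation. Sum and integral may be
  exchanged because on \<open>{..x}\<close> the \<open>n\<close>-th integrand is dominated by
  \<open>\<bar>q t\<bar> * C * (1/2)^n\<close>.\<close>

lemma phi_eq: "phi x = 1 + volterra phi x"
proof -
  obtain C where C: "\<And>n t. t \<le> x \<Longrightarrow> norm (phi_n n t) \<le> C * (1/2)^n" using phi_n_bound[of x] by blast
  let ?F = "\<lambda>n t. indicator {..x} t *\<^sub>R (kernel x t * of_real (q t) * phi_n n t)"
  have Fint: "integrable lebesgue (?F n)" for n
    using left_integrableD[OF volterra_integrable[OF phi_n_left_bounded]] by (simp add: set_integrable_def)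
  have qi: "integrable lebesgue (\<lambda>t. indicator {..x} t *\<^sub>R \<bar>q t\<bar>)"
    using left_integrableD[OF left_integrable_norm[OF q_left_integrable], of x] by (simp add: set_integrable_def)
  have Fle: "norm (?F n t) \<le> (indicator {..x} t *\<^sub>R \<bar>q t\<bar>) * (C * (1/2)^n)" for n t
  proof (cases "t \<le> x")
    case True
    have "norm (kernel x t) * \<bar>q t\<bar> * norm (phi_n n t) \<le> 1 * \<bar>q t\<bar> * (C * (1/2)^n)"
      using True by (intro mult_mono C norm_kernel_le) auto
    then show ?thesis using True by (simp add: norm_mult)
  qed simp
  have sums: "(\<lambda>n. integral\<^sup>L lebesgue (?F n)) sums (\<integral>t. (\<Sum>n. ?F n t) \<partial>lebesgue)"
  proof (rule sums_integral[OF Fint])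
    show "AE t in lebesgue. summable (\<lambda>n. norm (?F n t))"
    proof (rule AE_I2)
      fix t :: real
      show "summable (\<lambda>n. norm (?F n t))"
      proof (rule summable_comparison_test')
        show "summable (\<lambda>n. (indicator {..x} t *\<^sub>R \<bar>q t\<bar>) * (C * (1/2)^n))"
          by (intro summable_mult summable_geometric) simp
        show "norm (norm (?F n t)) \<le> (indicator {..x} t *\<^sub>R \<bar>q t\<bar>) * (C * (1/2)^n)" for n :: nat
          using Fle[where n=n and t=t] by (simp only: real_norm_def abs_norm_cancel)
      qed
    qed
    show "summable (\<lambda>n. \<integral>t. norm (?F n t) \<partial>lebesgue)"
    proof (rule summable_comparison_test')
      show "summable (\<lambda>n. (\<integral>t. indicator {..x} t *\<^sub>R \<bar>q t\<bar> \<partial>lebesgue) * (C * (1/2)^n))"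
          by (intro summable_mult summable_geometric) simp
      fix n :: nat
      have "(\<integral>t. norm (?F n t) \<partial>lebesgue) \<le> (\<integral>t. (indicator {..x} t *\<^sub>R \<bar>q t\<bar>) * (C * (1/2)^n) \<partial>lebesgue)"
        by (intro integral_mono integrable_norm Fint integrable_mult_left qi Fle)
      then show "norm (\<integral>t. norm (?F n t) \<partial>lebesgue) \<le> (\<integral>t. indicator {..x} t *\<^sub>R \<bar>q t\<bar> \<partial>lebesgue) * (C * (1/2)^n)"
        by (simp only: real_norm_def integral_mult_left_zero abs_of_nonneg[OF Bochner_Integration.integral_nonneg[OF norm_ge_zero]])
    qed
  qed
  have "(\<Sum>n. ?F n t) = indicator {..x} t *\<^sub>R (kernel x t * of_real (q t) * phi t)" for t
  proof -
    have s: "summable (\<lambda>n. phi_n n t)" by (rule summable_norm_cancel[OF phi_n_summable])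
    have "(\<Sum>n. ?F n t) = indicator {..x} t *\<^sub>R (\<Sum>n. kernel x t * of_real (q t) * phi_n n t)"
      by (rule suminf_scaleR_right[symmetric]) (rule summable_mult[OF s])
    also have "(\<Sum>n. kernel x t * of_real (q t) * phi_n n t) = kernel x t * of_real (q t) * phi t"
      unfolding phi_def phi0_def by (rule suminf_mult[OF s])
    finally show ?thesis .
  qed
  then have "(\<lambda>n. LINT t:{..x}|lebesgue. kernel x t * of_real (q t) * phi_n n t) sums
      (LINT t:{..x}|lebesgue. kernel x t * of_real (q t) * phi t)"
    using sums by (simp add: set_lebesgue_integral_def)
  then have "(\<lambda>n. phi_n (Suc n) x) sums volterra phi x"
    unfolding phi0_term_Suc volterra_def by (rule sums_mult)
  then have "(\<lambda>n. phi_n n x) sums (volterra phi x + phi_n 0 x)" by (rule sums_Suc)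
  then show ?thesis by (simp add: phi_def phi0_def sums_iff)
qed

end

section \<open>Derivatives of the Jost solution\<close>

lemma has_vector_derivative_Lipschitz_at:
  fixes f :: "real \<Rightarrow> 'a::real_normed_vector"
  assumes "(f has_vector_derivative f') (at x)"
  obtains M d where "0 < d" "0 \<le> M" "\<And>t. \<bar>t - x\<bar> < d \<Longrightarrow> norm (f t - f x) \<le> M * \<bar>t - x\<bar>"
proof -
  obtain d where d: "d > 0" "\<And>y. \<bar>y - x\<bar> < d \<Longrightarrow> norm (f y - f x - (y - x) *\<^sub>R f') \<le> 1 * \<bar>y - x\<bar>"
    using assms unfolding has_vector_derivative_def has_derivative_at_alt real_norm_def by (meson zero_less_one)
  have "norm (f t - f x) \<le> (norm f' + 1) * \<bar>t - x\<bar>" if "\<bar>t - x\<bar> < d" for t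
  proof -
    have "norm (f t - f x) \<le> norm (f t - f x - (t - x) *\<^sub>R f') + norm ((t - x) *\<^sub>R f')"
      using norm_triangle_ineq[of "f t - f x - (t - x) *\<^sub>R f'" "(t - x) *\<^sub>R f'"] by simp
    also have "\<dots> \<le> 1 * \<bar>t - x\<bar> + \<bar>t - x\<bar> * norm f'"
      using d(2)[OF that] by simp
    finally show ?thesis by (simp add: algebra_simps)
  qed
  then show ?thesis using d(1) by (intro that[of d "norm f' + 1"]) auto
qed

context left_jost
begin

definition u :: "real \<Rightarrow> complex" where "u = u0 m c w"
text \<open>Formal differentiation of \<open>conv \<zeta>\<close> brings down
  \<open>\<i> * z * \<zeta>\<close>. The coefficients \<open>zeta1\<close>, \<open>zeta2\<close> of
  \<open>u\<close> therefore turn into their squares \<open>zeta2\<close>, \<open>zeta1\<close> here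
  and into their cubes, both 1, in \<open>u2\<close>.\<close>

definition u1 :: "real \<Rightarrow> complex" where
  "u1 x = \<i> * z * exp (\<i> * z * of_real x) +
     (\<i> * z) ^ 2 / 3 * (conv 1 phi x + zeta2 * conv zeta1 phi x + zeta1 * conv zeta2 phi x)"
definition u2 :: "real \<Rightarrow> complex" where
  "u2 x = (\<i> * z) ^ 2 * exp (\<i> * z * of_real x) +
     (\<i> * z) ^ 3 / 3 * (conv 1 phi x + conv zeta1 phi x + conv zeta2 phi x)"

abbreviation "P \<equiv> primitive (weight phi)"

lemma u_phi: "u x = exp (\<i> * z * of_real x) * phi x"
  by (simp add: u_def u0_def z_def phi_def)

lemma weight_phi: "weight phi t = of_real (q t) * u t"
  by (simp add: weight_def u_phi)

lemma u_eq: "u x = exp (\<i> * z * of_real x) +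
     \<i> * z / 3 * (conv 1 phi x + zeta1 * conv zeta1 phi x + zeta2 * conv zeta2 phi x)"
  by (simp only: u_phi phi_eq[of x] distrib_left volterra_eq[OF phi_left_bounded] mult_1_right)

text \<open>Each convolution is differentiable only after subtraction of \<open>P\<close>, so the
  sum of the coefficients decides. It is 0 for \<open>u\<close> and \<open>u1\<close> because
  \<open>1 + zeta1 + zeta2 = 0\<close>, and \<open>(\<i> * z) ^ 3\<close> for
  \<open>u2\<close>.\<close>

lemma combination_deriv:
  "((\<lambda>y. a * exp (\<i> * z * of_real y) + (b1 * conv 1 phi y + b2 * conv zeta1 phi y + b3 * conv zeta2 phi y)
      - (b1 + b2 + b3) * P y) has_vector_derivative
    a * (\<i> * z) * exp (\<i> * z * of_real x) + (b1 * (\<i> * z) * conv 1 phi x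
      + b2 * (\<i> * z * zeta1) * conv zeta1 phi x + b3 * (\<i> * z * zeta2) * conv zeta2 phi x)) (at x)"
proof -
  have K: "((\<lambda>y. conv \<zeta> phi y - P y) has_vector_derivative \<i> * z * \<zeta> * conv \<zeta> phi x) (at x)"
    if "Re (\<i> * z * \<zeta>) \<le> Re (\<i> * z)" for \<zeta>
    by (intro exp_conv_deriv weight_left_integrable exp_weight_left_integrable phi_left_bounded that)
  have K1: "((\<lambda>y. conv 1 phi y - P y) has_vector_derivative \<i> * z * conv 1 phi x) (at x)"
    using K[of 1] by simp
  have E: "((\<lambda>y. exp (\<i> * z * of_real y)) has_vector_derivative \<i> * z * exp (\<i> * z * of_real x)) (at x)"
    by (auto intro!: derivative_eq_intros has_vector_derivative_real_field)
  have "((\<lambda>y. a * exp (\<i> * z * of_real y) + (b1 * (conv 1 phi y - P y) + b2 * (conv zeta1 phi y - P y) + b3 * (conv zeta2 phi y - P y)))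
     has_vector_derivative
    a * (\<i> * z * exp (\<i> * z * of_real x)) + (b1 * (\<i> * z * conv 1 phi x)
      + b2 * (\<i> * z * zeta1 * conv zeta1 phi x) + b3 * (\<i> * z * zeta2 * conv zeta2 phi x))) (at x)"
    by (intro has_vector_derivative_add has_vector_derivative_mult_right E K1 K exponents)
  moreover have "a * e + (b1 * (k1 - p) + b2 * (k2 - p) + b3 * (k3 - p)) =
    a * e + (b1 * k1 + b2 * k2 + b3 * k3) - (b1 + b2 + b3) * p" for e k1 k2 k3 p
    by (simp add: algebra_simps)
  ultimately show ?thesis
    by (simp only: mult.assoc)
qed

lemma u_deriv: "(u has_vector_derivative u1 x) (at x)"
proof -
  let ?k = "\<i> * z / 3"
  have "?k + ?k * zeta1 + ?k * zeta2 = ?k * (1 + (zeta1 + zeta2))"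
    by (simp only: distrib_left mult_1_right add.assoc)
  then have "?k + ?k * zeta1 + ?k * zeta2 = 0" by (simp only: zeta_sum) simp
  moreover have "u = (\<lambda>y. 1 * exp (\<i> * z * of_real y) + (?k * conv 1 phi y + (?k * zeta1) * conv zeta1 phi y + (?k * zeta2) * conv zeta2 phi y)
      - 0 * P y)"
    by (simp only: fun_eq_iff u_eq) (simp add: algebra_simps)
  moreover have "u1 x = 1 * (\<i> * z) * exp (\<i> * z * of_real x) + (?k * (\<i> * z) * conv 1 phi x
      + (?k * zeta1) * (\<i> * z * zeta1) * conv zeta1 phi x + (?k * zeta2) * (\<i> * z * zeta2) * conv zeta2 phi x)"
  proof -
    \<comment> \<open>Proved for free variables, with \<open>b * b\<close> and \<open>d * d\<close>
      left unreduced until \<open>zeta_squares\<close> is applied.\<close>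
    have "i * e + i ^ 2 / 3 * (k + b * b * k1 + d * d * k2) =
      1 * i * e + (i / 3 * i * k + i / 3 * b * (i * b) * k1 + i / 3 * d * (i * d) * k2)"
      for i e k k1 k2 b d :: complex by (simp add: algebra_simps power2_eq_square)
    from this[of "\<i> * z" _ _ zeta1 _ zeta2] show ?thesis
      by (simp only: u1_def zeta_squares)
  qed
  ultimately show ?thesis using combination_deriv[of 1 ?k "?k * zeta1" "?k * zeta2" x] by (simp only:)
qed

lemma u1_deriv: "(u1 has_vector_derivative u2 x) (at x)"
proof -
  let ?k = "(\<i> * z)^2 / 3"
  have "?k + ?k * zeta2 + ?k * zeta1 = ?k * (1 + (zeta1 + zeta2))"
    by (simp only: distrib_left mult_1_right add_ac)
  then have "?k + ?k * zeta2 + ?k * zeta1 = 0" by (simp only: zeta_sum) simp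
  moreover have "u1 = (\<lambda>y. (\<i> * z) * exp (\<i> * z * of_real y) + (?k * conv 1 phi y + (?k * zeta2) * conv zeta1 phi y + (?k * zeta1) * conv zeta2 phi y)
      - 0 * P y)"
    by (simp only: fun_eq_iff u1_def) (simp add: algebra_simps)
  moreover have "u2 x = (\<i> * z) * (\<i> * z) * exp (\<i> * z * of_real x) + (?k * (\<i> * z) * conv 1 phi x
      + (?k * zeta2) * (\<i> * z * zeta1) * conv zeta1 phi x + (?k * zeta1) * (\<i> * z * zeta2) * conv zeta2 phi x)"
  proof -
    have "i ^ 2 * e + i ^ 3 / 3 * (k + b * d * k1 + b * d * k2) =
      i * i * e + (i ^ 2 / 3 * i * k + i ^ 2 / 3 * d * (i * b) * k1 + i ^ 2 / 3 * b * (i * d) * k2)"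
      for i e k k1 k2 b d :: complex by (simp add: algebra_simps power2_eq_square power3_eq_cube)
    from this[of "\<i> * z" _ _ zeta1 zeta2] show ?thesis
      by (simp only: u2_def zeta_mult mult_1_left)
  qed
  ultimately show ?thesis using combination_deriv[of "\<i> * z" ?k "?k * zeta2" "?k * zeta1" x] by (simp only:)
qed

text \<open>The differential equation in integrated form: \<open>P\<close> is the primitive of
  \<open>q * u\<close>, and moving it to the left makes the identity hold at every point.\<close>

lemma u2_deriv: "((\<lambda>y. u2 y - (\<i> * z) ^ 3 * P y) has_vector_derivative (\<i> * z) ^ 3 * u x) (at x)"
proof -
  let ?k = "(\<i> * z)^3 / 3"
  have "?k + ?k + ?k = (\<i> * z)^3" by simp
  moreover have "(\<lambda>y. u2 y - (\<i> * z) ^ 3 * P y) = (\<lambda>y. (\<i> * z)^2 * exp (\<i> * z * of_real y) + (?k * conv 1 phi y + ?k * conv zeta1 phi y + ?k * conv zeta2 phi y)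
      - (\<i> * z)^3 * P y)"
    by (simp only: fun_eq_iff u2_def) (simp add: algebra_simps)
  moreover have "(\<i> * z) ^ 3 * u x = (\<i> * z)^2 * (\<i> * z) * exp (\<i> * z * of_real x) + (?k * (\<i> * z) * conv 1 phi x
      + ?k * (\<i> * z * zeta1) * conv zeta1 phi x + ?k * (\<i> * z * zeta2) * conv zeta2 phi x)"
  proof -
    have "i ^ 3 * (e + i / 3 * (k + b * k1 + d * k2)) =
      i ^ 2 * i * e + (i ^ 3 / 3 * i * k + i ^ 3 / 3 * (i * b) * k1 + i ^ 3 / 3 * (i * d) * k2)"
      for i e k k1 k2 b d :: complex by (simp add: algebra_simps power2_eq_square power3_eq_cube)
    then show ?thesis by (simp only: u_eq)
  qed
  ultimately show ?thesis using combination_deriv[of "(\<i> * z)^2" ?k ?k ?k x] by (simp only:)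
qed

section \<open>Decay at minus infinity\<close>

text \<open>On \<open>{..x}\<close> the integrand is at most
  \<open>exp ((Re (\<i> * z) - Re e) * x)\<close> times a multiple of \<open>norm (q t)\<close>,
  where \<open>e = \<i> * z * \<zeta>\<close>. The outer factor \<open>exp (e * x)\<close> restores
  the rate \<open>Re (\<i> * z)\<close>, whatever \<open>\<zeta>\<close> is.\<close>

lemma conv_bound:
  assumes "Re (\<i> * z * \<zeta>) \<le> Re (\<i> * z)"
  shows "\<exists>M. \<forall>x\<le>0. norm (conv \<zeta> phi x) \<le> exp (Re (\<i> * z) * x) * (M * primitive (\<lambda>t. norm (q t)) x)"
proof -
  obtain M where M: "\<And>t. t \<le> 0 \<Longrightarrow> norm (phi t) \<le> M" using phi_left_bounded by (auto simp: left_bounded_def)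
  show ?thesis
  proof (intro exI allI impI)
    fix x :: real assume x: "x \<le> 0"
    let ?e = "\<i> * z * \<zeta>"
    let ?d = "Re (\<i> * z) - Re ?e"
    have "norm (exp (- (?e * of_real t)) * weight phi t) \<le> exp (?d * x) * M * norm (q t)" if t: "t \<le> x" for t
    proof -
      have "norm (exp (- (?e * of_real t)) * weight phi t) = norm (exp (- (?e * of_real t)) * exp (\<i> * z * of_real t)) * norm (phi t) * norm (q t)"
        by (simp add: weight_def norm_mult)
      also have "norm (exp (- (?e * of_real t)) * exp (\<i> * z * of_real t)) = exp (?d * t)"
        by (simp add: exp_add[symmetric] norm_exp_eq_Re algebra_simps)
      also have "exp (?d * t) * norm (phi t) * norm (q t) \<le> exp (?d * x) * M * norm (q t)"
        using M[of t] t x assms by (intro mult_right_mono mult_mono) (auto intro: mult_left_mono)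
      finally show ?thesis .
    qed
    then have "norm (primitive (\<lambda>t. exp (- (?e * of_real t)) * weight phi t) x) \<le> primitive (\<lambda>t. exp (?d * x) * M * norm (q t)) x"
      unfolding primitive_def
      by (intro set_integral_norm_le left_integrableD exp_weight_left_integrable phi_left_bounded assms
          set_integrable_mult_right left_integrable_norm q_left_integrable) auto
    also have "\<dots> = exp (?d * x) * M * primitive (\<lambda>t. norm (q t)) x"
      by (simp only: primitive_def set_integral_mult_right)
    finally have "exp (Re ?e * x) * norm (primitive (\<lambda>t. exp (- (?e * of_real t)) * weight phi t) x)
        \<le> exp (Re ?e * x) * (exp (?d * x) * M * primitive (\<lambda>t. norm (q t)) x)"
      by (rule mult_left_mono) simp
    also have "\<dots> = exp (Re ?e * x + ?d * x) * (M * primitive (\<lambda>t. norm (q t)) x)"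
      by (simp only: exp_add mult.assoc)
    also have "Re ?e * x + ?d * x = Re (\<i> * z) * x" by (simp add: left_diff_distrib)
    finally show "norm (conv \<zeta> phi x) \<le> exp (Re (\<i> * z) * x) * (M * primitive (\<lambda>t. norm (q t)) x)"
      by (simp add: exp_conv_def norm_mult norm_exp_eq_Re)
  qed
qed

lemma exp_exponent_at_bot: "((\<lambda>x. exp (Re (\<i> * z) * x)) \<longlongrightarrow> 0) at_bot"
proof -
  have "filterlim (\<lambda>x. Re (\<i> * z) * x) at_bot at_bot"
    by (rule filterlim_tendsto_pos_mult_at_bot[OF tendsto_const exponents(1) filterlim_ident])
  then show ?thesis by (rule filterlim_compose[OF exp_at_bot])
qed

lemma conv_at_bot:
  assumes "Re (\<i> * z * \<zeta>) \<le> Re (\<i> * z)"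
  shows "(conv \<zeta> phi \<longlongrightarrow> 0) at_bot"
proof -
  obtain M where M: "\<And>x. x \<le> 0 \<Longrightarrow> norm (conv \<zeta> phi x) \<le> exp (Re (\<i> * z) * x) * (M * primitive (\<lambda>t. norm (q t)) x)"
    using conv_bound[OF assms] by blast
  have "((\<lambda>x. exp (Re (\<i> * z) * x) * (M * primitive (\<lambda>t. norm (q t)) x)) \<longlongrightarrow> 0 * (M * 0)) at_bot"
    by (intro tendsto_intros exp_exponent_at_bot primitive_at_bot left_integrable_norm q_left_integrable)
  then have "((\<lambda>x. exp (Re (\<i> * z) * x) * (M * primitive (\<lambda>t. norm (q t)) x)) \<longlongrightarrow> 0) at_bot"
    by (simp only: mult_zero_left)
  moreover have "eventually (\<lambda>x. norm (conv \<zeta> phi x) \<le> exp (Re (\<i> * z) * x) * (M * primitive (\<lambda>t. norm (q t)) x)) at_bot"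
    unfolding eventually_at_bot_linorder using M by blast
  ultimately show ?thesis by (rule Lim_null_comparison[rotated])
qed

lemma jost_at_bot: "(u \<longlongrightarrow> 0) at_bot" "(u1 \<longlongrightarrow> 0) at_bot" "(u2 \<longlongrightarrow> 0) at_bot"
proof -
  have E: "((\<lambda>x. exp (\<i> * z * of_real x)) \<longlongrightarrow> 0) at_bot"
    by (rule Lim_null_comparison[OF _ exp_exponent_at_bot]) (simp add: norm_exp_eq_Re)
  have K: "(conv 1 phi \<longlongrightarrow> 0) at_bot" "(conv zeta1 phi \<longlongrightarrow> 0) at_bot" "(conv zeta2 phi \<longlongrightarrow> 0) at_bot"
    by (intro conv_at_bot exponents; simp)+
  have "(u \<longlongrightarrow> 0 + \<i> * z / 3 * (0 + zeta1 * 0 + zeta2 * 0)) at_bot"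
    unfolding u_eq[abs_def] by (intro tendsto_intros E K)
  then show "(u \<longlongrightarrow> 0) at_bot" by simp
  have "(u1 \<longlongrightarrow> \<i> * z * 0 + (\<i> * z)^2 / 3 * (0 + zeta2 * 0 + zeta1 * 0)) at_bot"
    unfolding u1_def[abs_def] by (intro tendsto_intros E K)
  then show "(u1 \<longlongrightarrow> 0) at_bot" by simp
  have "(u2 \<longlongrightarrow> (\<i> * z)^2 * 0 + (\<i> * z)^3 / 3 * (0 + 0 + 0)) at_bot"
    unfolding u2_def[abs_def] by (intro tendsto_intros E K)
  then show "(u2 \<longlongrightarrow> 0) at_bot" by simp
qed

section \<open>Conservation of the flux\<close>

definition flux :: "real \<Rightarrow> real" where
  "flux x = 2 * Re (u2 x * cnj (u x)) - (norm (u1 x))\<^sup>2"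

text \<open>
  \<open>P\<close> alone need not be differentiable at \<open>x\<close>. Replacing \<open>u t\<close> by \<open>u x\<close> in the integrand \<open>q t * u t\<close> of \<open>P\<close>
  leaves a real multiple of \<open>k\<close>, which has no real part, and costs only \<open>O(\<bar>y - x\<bar>)\<close> times a small integral.
\<close>

lemma potential_remainder_deriv:
  assumes k: "Re k = 0"
  shows "((\<lambda>y. Re (k * cnj (u x) * (P y - P x))) has_vector_derivative 0) (at x)"
proof -
  define h where "h t = weight phi t - u x * of_real (q t)" for t
  have qc: "left_integrable (\<lambda>t. complex_of_real (q t))"
    using q_left_integrable by (simp add: left_integrable_def set_integrable_def scaleR_conv_of_real flip: of_real_mult)
  have h: "left_integrable h"
    unfolding h_def[abs_def] left_integrable_def
    by (intro allI set_integral_diff(1) set_integrable_mult_right left_integrableD weight_left_integrable phi_left_bounded qc)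
  have Ph: "primitive h y = P y - u x * of_real (primitive q y)" for y
    unfolding h_def[abs_def] primitive_def set_integral_complex_of_real[symmetric]
    by (simp only: set_integral_diff set_integral_mult_right set_integrable_mult_right left_integrableD
        weight_left_integrable[OF phi_left_bounded] qc)
  have "Re (k * cnj (u x) * (u x * of_real r)) = 0" for r
  proof -
    have "k * cnj (u x) * (u x * of_real r) = k * ((u x * cnj (u x)) * of_real r)"
      by (simp only: mult_ac)
    also have "\<dots> = k * of_real ((norm (u x))\<^sup>2 * r)"
      by (simp only: complex_norm_square[symmetric] of_real_mult)
    finally have "k * cnj (u x) * (u x * of_real r) = k * of_real ((norm (u x))\<^sup>2 * r)" .
    then show ?thesis using k by simp
  qed
  note this[of "primitive q y - primitive q x" for y]
  then have eq: "Re (k * cnj (u x) * (P y - P x)) = Re (k * cnj (u x) * (primitive h y - primitive h x))" for y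
    unfolding Ph by (simp add: algebra_simps)
  obtain M d where d: "0 < d" "0 \<le> M" and M: "\<And>t. \<bar>t - x\<bar> < d \<Longrightarrow> norm (u t - u x) \<le> M * \<bar>t - x\<bar>"
    using has_vector_derivative_Lipschitz_at[OF u_deriv] by blast
  show ?thesis unfolding eq
  proof (rule has_vector_derivative_zero_of_bound)
    show "isCont (primitive (\<lambda>t. norm (q t))) x"
      by (intro primitive_continuous left_integrable_norm q_left_integrable)
    have "eventually (\<lambda>y. dist y x < d) (at x)"
      using d(1) unfolding eventually_at by blast
    then show "eventually (\<lambda>y. norm (Re (k * cnj (u x) * (primitive h y - primitive h x)))
        \<le> (norm (k * cnj (u x)) * M) * \<bar>y - x\<bar> * \<bar>primitive (\<lambda>t. norm (q t)) y - primitive (\<lambda>t. norm (q t)) x\<bar>) (at x)"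
    proof eventually_elim
      case (elim y)
      have "norm (primitive h y - primitive h x) \<le> M * \<bar>y - x\<bar> * \<bar>primitive (\<lambda>t. norm (q t)) y - primitive (\<lambda>t. norm (q t)) x\<bar>"
      proof (rule primitive_diff_bound[OF h left_integrable_norm[OF q_left_integrable]])
        show "0 \<le> M * \<bar>y - x\<bar>" using d by simp
        fix t assume t: "min x y \<le> t" "t \<le> max x y"
        then have le: "\<bar>t - x\<bar> \<le> \<bar>y - x\<bar>" by auto
        then have "norm (u t - u x) \<le> M * \<bar>t - x\<bar>" using elim by (intro M) (auto simp: dist_real_def)
        also have "\<dots> \<le> M * \<bar>y - x\<bar>" using le d(2) by (rule mult_left_mono)
        finally have "norm (u t - u x) * norm (q t) \<le> M * \<bar>y - x\<bar> * norm (q t)"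
          by (rule mult_right_mono) simp
        moreover have "h t = (u t - u x) * of_real (q t)"
          by (simp add: h_def weight_phi algebra_simps)
        ultimately show "norm (h t) \<le> M * \<bar>y - x\<bar> * norm (q t)" by (simp add: norm_mult)
      qed
      then have "norm (k * cnj (u x)) * norm (primitive h y - primitive h x) \<le>
          norm (k * cnj (u x)) * (M * \<bar>y - x\<bar> * \<bar>primitive (\<lambda>t. norm (q t)) y - primitive (\<lambda>t. norm (q t)) x\<bar>)"
        by (rule mult_left_mono) simp
      moreover have "norm (Re (k * cnj (u x) * (primitive h y - primitive h x))) \<le> norm (k * cnj (u x)) * norm (primitive h y - primitive h x)"
        using abs_Re_le_cmod[of "k * cnj (u x) * (primitive h y - primitive h x)"]
        by (simp only: real_norm_def norm_mult)
      ultimately show ?case by (simp only: mult.assoc)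
    qed
  qed simp
qed

text \<open>\<open>P\<close> may fail to be differentiable at \<open>x\<close>, so the product rule
  does not apply. Instead one factor is \<open>O(|y - x|)\<close> and the other tends to 0 by
  continuity.\<close>

lemma cross_remainder_deriv:
  "((\<lambda>y. (P y - P x) * cnj (u y - u x)) has_vector_derivative 0) (at x)"
proof -
  obtain M d where d: "0 < d" and M: "\<And>t. \<bar>t - x\<bar> < d \<Longrightarrow> norm (u t - u x) \<le> M * \<bar>t - x\<bar>"
    using has_vector_derivative_Lipschitz_at[OF u_deriv] by blast
  show ?thesis
  proof (rule has_vector_derivative_zero_of_bound)
    show "isCont (\<lambda>y. norm (P y - P x)) x"
      by (intro continuous_intros primitive_continuous weight_left_integrable phi_left_bounded)
    have "eventually (\<lambda>y. dist y x < d) (at x)"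
      using d(1) unfolding eventually_at by blast
    then show "eventually (\<lambda>y. norm ((P y - P x) * cnj (u y - u x)) \<le> M * \<bar>y - x\<bar> * \<bar>norm (P y - P x) - norm (P x - P x)\<bar>) (at x)"
    proof eventually_elim
      case (elim y)
      then have "norm (P y - P x) * norm (u y - u x) \<le> norm (P y - P x) * (M * \<bar>y - x\<bar>)"
        by (intro mult_left_mono M) (auto simp: dist_real_def)
      then show ?case by (simp add: norm_mult mult_ac flip: complex_cnj_diff)
    qed
  qed simp
qed

lemma flux_deriv:
  assumes "z ^ 3 \<in> \<real>"
  shows "(flux has_vector_derivative 0) (at x)"
proof -
  define k where "k = (\<i> * z) ^ 3"
  have "\<i> ^ 3 = - \<i>" by (simp add: power3_eq_cube)
  then have "k = - \<i> * z ^ 3" by (simp add: k_def power_mult_distrib)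
  with assms have k: "Re k = 0" by (auto elim!: Reals_cases)
  define W where "W y = u2 y - k * P y" for y
  have W: "(W has_vector_derivative k * u x) (at x)"
    unfolding W_def[abs_def] k_def by (rule u2_deriv)
  have uc: "((\<lambda>y. cnj (u y)) has_vector_derivative cnj (u1 x)) (at x)" by (rule has_vector_derivative_cnj[OF u_deriv])
  have u1c: "((\<lambda>y. cnj (u1 y)) has_vector_derivative cnj (u2 x)) (at x)" by (rule has_vector_derivative_cnj[OF u1_deriv])
  \<comment> \<open>In the flux, \<open>u2 = W + k * P\<close>, and \<open>P y * cnj (u y)\<close>
    is expanded around \<open>x\<close>. \<open>F\<close> collects all terms except
    \<open>2 * k * cnj (u x) * (P y - P x)\<close>, for which only the real part has a known
    derivative.\<close>
  define F where "F y = 2 * (W y * cnj (u y)) - u1 y * cnj (u1 y)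
     + 2 * k * ((P y - P x) * cnj (u y - u x)) + 2 * k * P x * cnj (u y)" for y
  have "(F has_vector_derivative 2 * (W x * cnj (u1 x) + k * u x * cnj (u x)) - (u1 x * cnj (u2 x) + u2 x * cnj (u1 x))
      + 2 * k * 0 + 2 * k * P x * cnj (u1 x)) (at x)"
    unfolding F_def[abs_def]
    by (intro has_vector_derivative_add has_vector_derivative_diff has_vector_derivative_mult
        has_vector_derivative_mult_right W uc u1c u1_deriv cross_remainder_deriv)
  note bounded_linear.has_vector_derivative[OF bounded_linear_Re this]
  \<comment> \<open>The right-hand side is a number minus its conjugate plus a real multiple of the
    imaginary \<open>k\<close>, hence has no real part.\<close>
  moreover have "2 * (W x * cnj (u1 x) + k * u x * cnj (u x)) - (u1 x * cnj (u2 x) + u2 x * cnj (u1 x))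
      + 2 * k * 0 + 2 * k * P x * cnj (u1 x) = (u2 x * cnj (u1 x) - cnj (u2 x * cnj (u1 x))) + 2 * (k * of_real ((norm (u x))\<^sup>2))"
    unfolding W_def complex_norm_square by (simp add: algebra_simps)
  moreover have "Re \<dots> = 0" using k by simp
  ultimately have "((\<lambda>y. Re (F y)) has_vector_derivative 0) (at x)" by (simp only:)
  then have "((\<lambda>y. Re (F y) + 2 * Re (k * cnj (u x) * (P y - P x))) has_vector_derivative 0 + 2 * 0) (at x)"
    by (intro has_vector_derivative_add has_vector_derivative_mult_right potential_remainder_deriv k)
  moreover have flux_eq: "flux y = Re (F y) + 2 * Re (k * cnj (u x) * (P y - P x))" for y
  proof -
    have "(norm (u1 y))\<^sup>2 = Re (u1 y * cnj (u1 y))"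
      by (simp add: complex_norm_square[symmetric] del: of_real_power)
    moreover have "F y + 2 * (k * cnj (u x) * (P y - P x)) = 2 * (u2 y * cnj (u y)) - u1 y * cnj (u1 y)"
      unfolding F_def W_def by (simp add: algebra_simps)
    then have "Re (F y + 2 * (k * cnj (u x) * (P y - P x))) = Re (2 * (u2 y * cnj (u y)) - u1 y * cnj (u1 y))" by (rule arg_cong)
    ultimately show ?thesis unfolding flux_def by simp
  qed
  ultimately show ?thesis by (simp only: flux_eq[abs_def] mult_zero_right add_0_right)
qed

lemma flux_zero:
  assumes "z ^ 3 \<in> \<real>"
  shows "2 * Re (u2 x * cnj (u x)) = (norm (u1 x))\<^sup>2"
proof -
  have "(flux \<longlongrightarrow> 2 * Re (0 * cnj 0) - (norm (0::complex))\<^sup>2) at_bot"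
    unfolding flux_def[abs_def] by (intro tendsto_intros jost_at_bot)
  then have lim: "(flux \<longlongrightarrow> 0) at_bot" by simp
  have "flux y = flux x" for y
    using has_vector_derivative_zero_constant[of UNIV flux] flux_deriv[OF assms] by (metis UNIV_I convex_UNIV)
  then have "flux = (\<lambda>_. flux x)" by blast
  with lim have "((\<lambda>_. flux x) \<longlongrightarrow> 0) (at_bot :: real filter)" by simp
  then have "flux x = 0" by (simp add: tendsto_const_iff)
  then show ?thesis by (simp add: flux_def)
qed

section \<open>Monotonicity of the squared modulus\<close>

text \<open>The product rule gives \<open>(norm u1)\<^sup>2 + Re (u2 * cnj u)\<close>, and vanishing
  flux makes the second term half of the first.\<close>

lemma momentum_deriv:
  assumes "z ^ 3 \<in> \<real>"
  shows "((\<lambda>y. Re (u1 y * cnj (u y))) has_real_derivative 3/2 * (norm (u1 x))\<^sup>2) (at x)"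
proof -
  have "((\<lambda>y. Re (u1 y * cnj (u y))) has_real_derivative Re (u1 x * cnj (u1 x) + u2 x * cnj (u x))) (at x)"
    by (intro has_field_derivative_Re has_vector_derivative_mult u1_deriv has_vector_derivative_cnj u_deriv)
  moreover have "Re (u1 x * cnj (u1 x) + u2 x * cnj (u x)) = 3/2 * (norm (u1 x))\<^sup>2"
    using flux_zero[OF assms, of x] by (simp add: complex_norm_square[symmetric] del: of_real_power)
  ultimately show ?thesis by (simp only:)
qed

text \<open>The quantity is nondecreasing with limit 0 at minus infinity, so if it were not positive
  at \<open>x\<close> it would vanish on \<open>{..x}\<close>. Then \<open>norm u\<close> would be
  constant there, hence 0 by decay, and the integral equation would give \<open>phi x = 1\<close>, a
  contradiction.\<close>

lemma momentum_pos:
  assumes "z ^ 3 \<in> \<real>"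
  shows "0 < Re (u1 x * cnj (u x))"
proof (rule ccontr)
  let ?p = "\<lambda>y. Re (u1 y * cnj (u y))"
  assume not_pos: "\<not> 0 < ?p x"
  have mono: "?p y \<le> ?p y'" if "y \<le> y'" for y y'
    using momentum_deriv[OF assms] by (intro DERIV_nonneg_imp_nondecreasing[OF that]) force
  have "(?p \<longlongrightarrow> Re (0 * cnj 0)) at_bot" by (intro tendsto_intros jost_at_bot)
  then have lim: "(?p \<longlongrightarrow> 0) at_bot" by simp
  have nonneg: "0 \<le> ?p y" for y
  proof (rule tendsto_upperbound[OF lim])
    show "eventually (\<lambda>y'. ?p y' \<le> ?p y) at_bot"
      unfolding eventually_at_bot_linorder using mono by blast
  qed simp
  have zero: "?p y = 0" if "y \<le> x" for y
    using nonneg[of y] mono[OF that] not_pos by linarith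
  have n_deriv: "((\<lambda>y. Re (u y * cnj (u y))) has_real_derivative 2 * ?p y) (at y)" for y
  proof -
    have "((\<lambda>y. Re (u y * cnj (u y))) has_real_derivative Re (u y * cnj (u1 y) + u1 y * cnj (u y))) (at y)"
      by (intro has_field_derivative_Re has_vector_derivative_mult has_vector_derivative_cnj u_deriv)
    moreover have "Re (u y * cnj (u1 y) + u1 y * cnj (u y)) = 2 * ?p y" by simp
    ultimately show ?thesis by (simp only:)
  qed
  have const: "Re (u y * cnj (u y)) = Re (u y' * cnj (u y'))" if "y \<le> y'" "y' \<le> x" for y y'
    using that
  proof (intro antisym)
    show "Re (u y * cnj (u y)) \<le> Re (u y' * cnj (u y'))"
    proof (rule DERIV_nonneg_imp_nondecreasing[OF that(1)])
      fix s
      show "\<exists>d. ((\<lambda>y. Re (u y * cnj (u y))) has_real_derivative d) (at s) \<and> 0 \<le> d"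
        using n_deriv[of s] nonneg[of s] by (intro exI[of _ "2 * ?p s"]) simp
    qed
    show "Re (u y' * cnj (u y')) \<le> Re (u y * cnj (u y))"
    proof (rule DERIV_nonpos_imp_nonincreasing[OF that(1)])
      fix s assume "y \<le> s" "s \<le> y'"
      then have "?p s = 0" using that by (intro zero) simp
      then show "\<exists>d. ((\<lambda>y. Re (u y * cnj (u y))) has_real_derivative d) (at s) \<and> d \<le> 0"
        using n_deriv[of s] by (intro exI[of _ "2 * ?p s"]) simp
    qed
  qed
  have "((\<lambda>y. Re (u y * cnj (u y))) \<longlongrightarrow> Re (0 * cnj 0)) at_bot" by (intro tendsto_intros jost_at_bot)
  then have nlim: "((\<lambda>y. Re (u y * cnj (u y))) \<longlongrightarrow> 0) at_bot" by simp
  have phi_zero: "phi y = 0" if "y \<le> x" for y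
  proof -
    have "eventually (\<lambda>s. Re (u s * cnj (u s)) = Re (u y * cnj (u y))) at_bot"
      unfolding eventually_at_bot_linorder using const that by blast
    then have "((\<lambda>s. Re (u s * cnj (u s))) \<longlongrightarrow> Re (u y * cnj (u y))) at_bot"
      by (rule tendsto_eventually)
    then have "Re (u y * cnj (u y)) = 0" using nlim by (intro tendsto_unique[OF _ _ nlim]) simp_all
    then have "u y = 0" by (simp add: complex_eq_iff flip: power2_eq_square)
    then show ?thesis by (simp add: u_phi)
  qed
  have "(LINT t:{..x}|lebesgue. kernel x t * of_real (q t) * phi t) = (LINT t:{..x}|lebesgue. 0)"
    by (rule set_lebesgue_integral_cong) (auto simp: phi_zero)
  then have "phi x = 1" by (simp add: phi_eq[of x] volterra_def)
  then show False using phi_zero[of x] by simp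
qed

end

section \<open>Reflection of the real line\<close>

lemma lebesgue_reflect:
  "distr lebesgue lebesgue uminus = (lebesgue :: real measure)"
  "(uminus :: real \<Rightarrow> real) \<in> lebesgue \<rightarrow>\<^sub>M lebesgue"
proof -
  show "distr lebesgue lebesgue uminus = (lebesgue :: real measure)"
    using lebesgue_real_affine[of "-1" 0] by (simp add: density_1)
  show "(uminus :: real \<Rightarrow> real) \<in> lebesgue \<rightarrow>\<^sub>M lebesgue"
    using lebesgue_measurable_scaling[of "-1", where 'a=real] by (simp add: scaleR_minus1_left[abs_def])
qed

lemma integrable_lebesgue_reflect:
  fixes f :: "real \<Rightarrow> 'a::{banach, second_countable_topology}"
  shows "integrable lebesgue (\<lambda>x. f (- x)) \<longleftrightarrow> integrable lebesgue f"
proof -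
  have *: "integrable lebesgue (\<lambda>x. g (- x))" if "integrable lebesgue g" for g :: "real \<Rightarrow> 'a"
    using that by (intro integrable_distr[OF lebesgue_reflect(2)]) (simp only: lebesgue_reflect(1))
  show ?thesis using *[of f] *[of "\<lambda>x. f (- x)"] by auto
qed

lemma integral_lebesgue_reflect:
  fixes f :: "real \<Rightarrow> 'a::{banach, second_countable_topology}"
  shows "(\<integral>x. f (- x) \<partial>lebesgue) = (\<integral>x. f x \<partial>lebesgue)"
proof (cases "integrable lebesgue f")
  case True
  then have "(\<integral>x. f x \<partial>distr lebesgue lebesgue uminus) = (\<integral>x. f (- x) \<partial>lebesgue)"
    by (intro integral_distr lebesgue_reflect(2) borel_measurable_integrable)
  then show ?thesis by (simp only: lebesgue_reflect(1))
next
  case False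
  then show ?thesis by (simp add: not_integrable_integral_eq integrable_lebesgue_reflect)
qed

lemma set_integrable_atLeast_reflect:
  fixes f :: "real \<Rightarrow> 'a::{banach, second_countable_topology}"
  shows "set_integrable lebesgue {x..} f \<longleftrightarrow> set_integrable lebesgue {..- x} (\<lambda>t. f (- t))"
proof -
  have eq: "indicator {x..} (- t) = (indicator {..- x} t :: real)" for t by (auto split: split_indicator)
  show ?thesis unfolding set_integrable_def
    by (subst integrable_lebesgue_reflect[symmetric]) (simp only: eq)
qed

lemma set_integral_atLeast_reflect:
  fixes f :: "real \<Rightarrow> 'a::{banach, second_countable_topology}"
  shows "(LINT t:{x..}|lebesgue. f t) = (LINT t:{..- x}|lebesgue. f (- t))"
proof -
  have eq: "indicator {x..} (- t) = (indicator {..- x} t :: real)" for t by (auto split: split_indicator)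
  show ?thesis unfolding set_lebesgue_integral_def
    by (subst integral_lebesgue_reflect[symmetric]) (simp only: eq)
qed

lemma zpar_minus: "zpar c (- w) = - zpar c w"
  by (simp add: zpar_def)

text \<open>Substituting \<open>- t\<close> for \<open>t\<close> exchanges the half-lines and
  negates all differences \<open>x - t\<close>. Negating \<open>z\<close> as well restores the
  kernel and accounts for the opposite sign in front of the integral.\<close>

lemma psi0_term_reflect: "psi0_term m c w n x = phi0_term (\<lambda>t. m (- t)) c (- w) n (- x)"
proof (induction n arbitrary: x)
  case (Suc n)
  show ?case
    unfolding psi0_term.simps phi0_term.simps set_integral_atLeast_reflect[of x] Suc zpar_minus
    by (simp add: minus_diff_eq algebra_simps)
qed simp

lemma v0_reflect: "v0 m c w x = u0 (\<lambda>t. m (- t)) c (- w) (- x)"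
  by (simp add: v0_def u0_def psi0_def phi0_def psi0_term_reflect zpar_minus)

section \<open>Integrability of the potential\<close>

text \<open>A pointwise form of Cauchy-Schwarz: \<open>2 * \<bar>f\<bar> \<le> (\<bar>f\<bar> *
  e)\<^sup>2 + (inverse e)\<^sup>2\<close> with \<open>e = exp (a * t)\<close>, and both terms on
  the right are integrable.\<close>

lemma set_integrable_of_weighted_square:
  fixes f :: "real \<Rightarrow> real"
  assumes "0 < a" and f: "f \<in> borel_measurable lebesgue"
    and sq: "set_integrable lebesgue {0..} (\<lambda>t. \<bar>f t\<bar>\<^sup>2 * exp (2 * a * \<bar>t\<bar>))"
  shows "set_integrable lebesgue {0..} f"
proof -
  have "(\<lambda>t. exp (- (2 * a) * t)) integrable_on {0..}"
    using has_integral_exp_minus_to_infinity[of "2 * a" 0] assms(1) by (auto simp: integrable_on_def)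
  then have "set_integrable lebesgue {0..} (\<lambda>t. exp (- (2 * a) * t))"
    by (intro nonnegative_absolutely_integrable_1) auto
  then have "set_integrable lebesgue {0..} (\<lambda>t. \<bar>f t\<bar>\<^sup>2 * exp (2 * a * \<bar>t\<bar>) + exp (- (2 * a) * t))"
    using sq by (intro set_integral_add)
  then show ?thesis
  proof (rule set_integrable_bound)
    show "set_borel_measurable lebesgue {0..} f"
      unfolding set_borel_measurable_def by (intro borel_measurable_scaleR borel_measurable_indicator f) auto
    have "\<bar>f t\<bar> \<le> \<bar>f t\<bar>\<^sup>2 * exp (2 * a * \<bar>t\<bar>) + exp (- (2 * a) * t)" if "0 \<le> t" for t
    proof -
      define e where "e = exp (a * t)"
      have e: "0 < e" "exp (2 * a * \<bar>t\<bar>) = e\<^sup>2" "exp (- (2 * a) * t) = (inverse e)\<^sup>2"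
        using that by (simp_all add: e_def exp_minus power2_eq_square inverse_mult_distrib[symmetric] flip: exp_add)
      have "2 * ((\<bar>f t\<bar> * e) * inverse e) \<le> (\<bar>f t\<bar> * e)\<^sup>2 + (inverse e)\<^sup>2"
        using sum_squares_bound[of "\<bar>f t\<bar> * e" "inverse e"] by simp
      moreover have "(\<bar>f t\<bar> * e) * inverse e = \<bar>f t\<bar>" using e(1) by simp
      ultimately have "2 * \<bar>f t\<bar> \<le> \<bar>f t\<bar>\<^sup>2 * e\<^sup>2 + (inverse e)\<^sup>2" by (simp only: power_mult_distrib)
      then show ?thesis unfolding e(2,3) by linarith
    qed
    then show "AE t in lebesgue. t \<in> {0..} \<longrightarrow> norm (f t) \<le> norm (\<bar>f t\<bar>\<^sup>2 * exp (2 * a * \<bar>t\<bar>) + exp (- (2 * a) * t))"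
      by (intro AE_I2) force
  qed
qed

text \<open>The condition on the left controls \<open>{..0}\<close>. On
  \<open>{0..\<bar>y\<bar>}\<close> the condition on the right handles \<open>m - d\<close>, and the
  constant \<open>d - c\<close> is integrable over this bounded interval.\<close>

lemma left_integrable_potential:
  fixes m :: "real \<Rightarrow> real"
  assumes "0 < a" "0 < c" and m: "m \<in> borel_measurable lebesgue"
    and right: "set_integrable lebesgue {0..} (\<lambda>t. \<bar>m t - d\<bar>\<^sup>2 * exp (2 * a * \<bar>t\<bar>))"
    and left: "set_integrable lebesgue {..0} (\<lambda>t. \<bar>m t - c\<bar>\<^sup>2 * exp (2 * a * \<bar>t\<bar>))"
  shows "left_integrable (\<lambda>t. m t / c - 1)"
  unfolding left_integrable_def
proof
  fix y
  have "(\<lambda>t. m (- t)) \<in> borel_measurable lebesgue"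
    using measurable_compose[OF lebesgue_reflect(2) m] .
  then have "(\<lambda>t. m (- t) - c) \<in> borel_measurable lebesgue"
    by (intro borel_measurable_diff borel_measurable_const)
  moreover have "set_integrable lebesgue {0..} (\<lambda>t. \<bar>m (- t) - c\<bar>\<^sup>2 * exp (2 * a * \<bar>t\<bar>))"
    using left set_integrable_atLeast_reflect[of 0 "\<lambda>t. \<bar>m (- t) - c\<bar>\<^sup>2 * exp (2 * a * \<bar>t\<bar>)"]
    by simp
  ultimately have "set_integrable lebesgue {0..} (\<lambda>t. m (- t) - c)"
    by (rule set_integrable_of_weighted_square[OF assms(1)])
  then have L: "set_integrable lebesgue {..0} (\<lambda>t. m t - c)"
    using set_integrable_atLeast_reflect[of 0 "\<lambda>t. m (- t) - c"] by simp
  have "set_integrable lebesgue {0..} (\<lambda>t. m t - d)"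
    by (intro set_integrable_of_weighted_square[OF assms(1) _ right] borel_measurable_diff m borel_measurable_const)
  then have "set_integrable lebesgue {0..\<bar>y\<bar>} (\<lambda>t. m t - d)"
    by (rule set_integrable_subset) auto
  moreover have "set_integrable lebesgue {0..\<bar>y\<bar>} (\<lambda>t. d - c)"
    by (intro absolutely_integrable_continuous_real continuous_intros)
  ultimately have "set_integrable lebesgue {0..\<bar>y\<bar>} (\<lambda>t. (m t - d) + (d - c))"
    by (rule set_integral_add)
  with L have "set_integrable lebesgue ({..0} \<union> {0..\<bar>y\<bar>}) (\<lambda>t. m t - c)"
    by (intro set_integrable_Un) simp_all
  then have "set_integrable lebesgue {..y} (\<lambda>t. m t - c)"
    by (rule set_integrable_subset) auto
  then have "set_integrable lebesgue {..y} (\<lambda>t. (m t - c) / c)"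
    by (rule set_integrable_divide)
  then show "set_integrable lebesgue {..y} (\<lambda>t. m t / c - 1)"
    using assms(2) by (simp add: diff_divide_distrib)
qed

section \<open>Nonvanishing of the concomitant and conclusion\<close>

lemma concomitant_nonzero:
  fixes a a1 a2 b b1 b2 :: complex
  assumes "2 * Re (a2 * cnj a) = (norm a1)\<^sup>2" "0 < Re (a1 * cnj a)"
    and "2 * Re (b2 * cnj b) = (norm b1)\<^sup>2" "Re (b1 * cnj b) < 0"
  shows "a * b2 - a1 * b1 + a2 * b \<noteq> 0"
proof
  assume zero: "a * b2 - a1 * b1 + a2 * b = 0"
  have nz: "a \<noteq> 0" "b \<noteq> 0" using assms by auto
  have Re_div: "Re (x / y) = Re (x * cnj y) / (norm y)\<^sup>2" for x y
    unfolding complex_div_cnj[of x y] of_real_power[symmetric] Re_divide_of_real ..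
  define p r where "p = a1 / a" and "r = b1 / b"
  have p: "Re (a2 / a) = (norm p)\<^sup>2 / 2" "0 < Re p"
  proof -
    have "Re (a2 * cnj a) = (norm a1)\<^sup>2 / 2" using assms(1) by linarith
    then show "Re (a2 / a) = (norm p)\<^sup>2 / 2" by (simp only: Re_div p_def norm_divide power_divide) simp
    show "0 < Re p" unfolding p_def Re_div using assms(2) nz by (intro divide_pos_pos) simp_all
  qed
  have r: "Re (b2 / b) = (norm r)\<^sup>2 / 2" "Re r < 0"
  proof -
    have "Re (b2 * cnj b) = (norm b1)\<^sup>2 / 2" using assms(3) by linarith
    then show "Re (b2 / b) = (norm r)\<^sup>2 / 2" by (simp only: Re_div r_def norm_divide power_divide) simp
    show "Re r < 0" unfolding r_def Re_div using assms(4) nz by (intro divide_neg_pos) simp_all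
  qed
  have "b2 / b - p * r + a2 / a = (a * b2 - a1 * b1 + a2 * b) / (a * b)"
    using nz by (simp add: p_def r_def add_divide_distrib diff_divide_distrib)
  then have "Re (b2 / b - p * r + a2 / a) = 0" using zero by simp
  then have "(norm r)\<^sup>2 / 2 + (norm p)\<^sup>2 / 2 = Re (p * r)" using p r by simp
  \<comment> \<open>The left-hand side is the square of \<open>norm (p - cnj r)\<close>, that is
    \<open>(norm p)\<^sup>2 + (norm r)\<^sup>2 - 2 * Re (p * r)\<close>.\<close>
  then have "(Re p - Re r)\<^sup>2 + (Im p + Im r)\<^sup>2 = 0"
    unfolding cmod_power2 by (simp add: power2_eq_square field_simps)
  then have "Re p - Re r = 0" by (simp add: sum_power2_eq_zero_iff)
  then show False using p r by simp
qed

lemma t00_nonzero: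
  fixes m :: "real \<Rightarrow> real" and mp mm a x :: real and w :: complex
  assumes m: "m \<in> borel_measurable lebesgue"
    and pos: "0 < mp" "0 < mm" "0 < a"
    and right: "set_integrable lebesgue {0..} (\<lambda>t. \<bar>m t - mp\<bar>\<^sup>2 * exp (2 * a * \<bar>t\<bar>))"
    and left: "set_integrable lebesgue {..0} (\<lambda>t. \<bar>m t - mm\<bar>\<^sup>2 * exp (2 * a * \<bar>t\<bar>))"
    and w: "w \<in> Omega0_minus" "w ^ 3 \<in> \<real>"
  shows "t00 m mp mm x w \<noteq> 0"
proof -
  let ?m = "\<lambda>t. m (- t)" and ?w = "- cnj w"
  interpret U: left_jost m mm w
    using pos m left right w(1) by unfold_locales (auto intro: left_integrable_potential)
  \<comment> \<open>Conjugation in \<open>v0_plus\<close> replaces \<open>w\<close> by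
    \<open>cnj w\<close>, and reflection of the line negates it. \<open>Omega0_minus\<close> is
    symmetric about the imaginary axis, so the resulting parameter stays in it.\<close>
  interpret V: left_jost ?m mp ?w
  proof unfold_locales
    show m': "?m \<in> borel_measurable lebesgue" by (rule measurable_compose[OF lebesgue_reflect(2) m])
    show "?w \<in> Omega0_minus" using w(1) by (simp add: Omega0_minus_iff)
    show "left_integrable (\<lambda>t. ?m t / mp - 1)"
      using left right set_integrable_atLeast_reflect[of 0 "\<lambda>t. \<bar>m t - mp\<bar>\<^sup>2 * exp (2 * a * \<bar>t\<bar>)"]
        set_integrable_atLeast_reflect[of 0 "\<lambda>t. \<bar>m (- t) - mm\<bar>\<^sup>2 * exp (2 * a * \<bar>t\<bar>)"]
      by (intro left_integrable_potential[OF pos(3) pos(1) m', of mm]) simp_all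
  qed (use pos in simp)
  have zU: "U.z ^ 3 \<in> \<real>"
    unfolding U.z_def zpar_def power_mult_distrib by (intro Reals_mult w Reals_power Reals_of_real)
  have "V.z ^ 3 = - (cnj (w ^ 3) * of_real (root 3 mp) ^ 3)"
    by (simp add: V.z_def zpar_def power_mult_distrib power3_eq_cube)
  then have zV: "V.z ^ 3 \<in> \<real>"
    using w(2) by (auto simp: Reals_cnj_iff elim!: Reals_cases)
  have v: "v0_plus m mp w = (\<lambda>y. cnj (V.u (- y)))"
    by (simp add: v0_plus_def V.u_def v0_reflect fun_eq_iff)
  have refl: "((\<lambda>y. cnj (f (- y))) has_vector_derivative - cnj f') (at y)"
    if "(f has_vector_derivative f') (at (- y))" for f f' y
  proof -
    have "(uminus has_vector_derivative (-1)) (at y)"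
      by (auto intro!: derivative_eq_intros)
    from vector_diff_chain_at[OF this that] have "((\<lambda>y. f (- y)) has_vector_derivative - f') (at y)"
      by (simp add: o_def)
    from has_vector_derivative_cnj[OF this] show ?thesis by simp
  qed
  have Du: "Dx U.u = U.u1" "Dx U.u1 = U.u2"
    by (auto simp: Dx_def fun_eq_iff intro!: vector_derivative_at U.u_deriv U.u1_deriv)
  \<comment> \<open>Each differentiation of the reflected function contributes a factor -1: the
    first derivative changes sign, which makes the momentum of \<open>v\<close> negative, while the
    second keeps its sign and the flux relation persists.\<close>
  have Dv: "Dx (\<lambda>y. cnj (V.u (- y))) = (\<lambda>y. - cnj (V.u1 (- y)))"
    by (auto simp: Dx_def fun_eq_iff intro!: vector_derivative_at refl V.u_deriv)
  have DDv: "Dx (\<lambda>y. - cnj (V.u1 (- y))) = (\<lambda>y. cnj (V.u2 (- y)))"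
  proof -
    have "((\<lambda>y. - cnj (V.u1 (- y))) has_vector_derivative - (- cnj (V.u2 (- y)))) (at y)" for y
      by (intro has_vector_derivative_minus refl V.u1_deriv)
    then show ?thesis by (simp add: Dx_def fun_eq_iff vector_derivative_at)
  qed
  have "U.u x * cnj (V.u2 (- x)) - U.u1 x * (- cnj (V.u1 (- x))) + U.u2 x * cnj (V.u (- x)) \<noteq> 0"
  proof (rule concomitant_nonzero)
    show "2 * Re (U.u2 x * cnj (U.u x)) = (norm (U.u1 x))\<^sup>2" by (rule U.flux_zero[OF zU])
    show "0 < Re (U.u1 x * cnj (U.u x))" by (rule U.momentum_pos[OF zU])
    show "2 * Re (cnj (V.u2 (- x)) * cnj (cnj (V.u (- x)))) = (norm (- cnj (V.u1 (- x))))\<^sup>2"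
      using V.flux_zero[OF zV, of "- x"] by simp
    show "Re (- cnj (V.u1 (- x)) * cnj (cnj (V.u (- x)))) < 0"
      using V.momentum_pos[OF zV, of "- x"] by simp
  qed
  moreover have "w \<noteq> 0" using w(1) by (auto simp: Omega0_minus_iff)
  ultimately show ?thesis
    using pos(1) unfolding t00_def U.u_def[symmetric] v Du Dv DDv by simp
qed

lemma zeta_cubes: "zeta1 ^ 3 = 1" "zeta2 ^ 3 = 1"
  by (simp_all add: power3_eq_cube zeta_squares zeta_mult mult.commute)

theorem lemma2p5:
  fixes m :: "real \<Rightarrow> real" and mp mm a x :: real
  assumes "m \<in> borel_measurable lebesgue"
    and "(m \<longlongrightarrow> mp) at_top" and "(m \<longlongrightarrow> mm) at_bot"
    and "0 < mp" and "0 < mm" and "0 < a"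
    and "set_integrable lebesgue {0..} (\<lambda>t. \<bar>m t - mp\<bar>\<^sup>2 * exp (2 * a * \<bar>t\<bar>))"
    and "set_integrable lebesgue {..0} (\<lambda>t. \<bar>m t - mm\<bar>\<^sup>2 * exp (2 * a * \<bar>t\<bar>))"
  defines "Z \<equiv> {w \<in> Omega0_minus. t00 m mp mm x w = 0}"
  shows "finite {w \<in> Z. \<exists>\<mu>>0. w = of_real \<mu> * zeta2}
    \<and> finite {w \<in> Z. \<exists>\<nu><0. w = of_real \<nu> * zeta1}
    \<and> (\<forall>w \<in> {w \<in> Z. \<exists>\<mu>>0. w = of_real \<mu> * zeta2} \<union> {w \<in> Z. \<exists>\<nu><0. w = of_real \<nu> * zeta1}.
         zorder (t00 m mp mm x) w = 2)"
proof -
  have "w \<notin> Z" if "w ^ 3 \<in> \<real>" for w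
    using t00_nonzero[OF assms(1,4-8) _ that] by (auto simp: Z_def)
  \<comment> \<open>Both roots have cube 1, so the cube of a real multiple of either is real; this
    covers both rays.\<close>
  moreover have "(of_real \<mu> * zeta1) ^ 3 \<in> \<real>" "(of_real \<mu> * zeta2) ^ 3 \<in> \<real>" for \<mu>
    by (simp_all add: power_mult_distrib zeta_cubes)
  ultimately have empty: "{w \<in> Z. \<exists>\<mu>>0. w = of_real \<mu> * zeta2} = {}" "{w \<in> Z. \<exists>\<nu><0. w = of_real \<nu> * zeta1} = {}"
    by auto
  show ?thesis unfolding empty by simp
qed

end
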